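(* Let $X,Y$ be compacta and let $L$ be a compact Lawson lattice. The set $\mathcal{CSA}\mathrm{mb}_L(X,Y)$ of all strict $L$-ambiguous representations between $X$ and $Y$, ordered by inclusion, is a lattice. Moreover, with the topology determined by the requirement that the (injective) mapping $R\mapsto R^{\cup}$ from $\mathcal{CSA}\mathrm{mb}_L(X,Y)$ to $\exp(\exp^2X\times\exp Y\times L)$ be a topological embedding, $\mathcal{CSA}\mathrm{mb}_L(X,Y)$ is a compact Hausdorff Lawson upper semilattice.
   Context: A compactum is a compact Hausdorff space. For a compactum $K$, $\exp K$ is the set of all non-empty closed subsets of $K$ with the Vietoris topology (base: $\langle U_1,\dots,U_n\rangle=\{F\in\exp K\mid F\subset U_1\cup\dots\cup U_n,\ F\cap U_i\neq\varnothing\ \forall i\}$, $U_i$ open in $K$); it is a compactum, and $\exp^2K=\exp(\exp K)$. A topological upper (lower) semilattice is Lawson if each point has a local base consisting of upper (resp. lower) subsemilattices. A Lawson lattice is a distributive topological lattice that is both an upper and a lower Lawson semilattice. All topological (semi)lattices are assumed Hausdorff; $0$ and $1$ denote the bottom and top elements of $L$. An $L$-ambiguous representation between $X$ and $Y$ is a subset $R\subset\exp X\times\exp Y\times L$ such that: (a) if $A'\subset A$, $B\subset B'$ ($A,A'\in\exp X$, $B,B'\in\exp Y$), $\alpha\ge\alpha'$ in $L$ and $(A,B,\alpha)\in R$, then $(A',B',\alpha')\in R$; (b) if $(A,B,\alpha),(A,B,\beta)\in R$, then $(A,B,\alpha\vee\beta)\in R$; (c) $(A,Y,\alpha)\in R$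 and $(A,B,0)\in R$ for all $A\in\exp X$, $B\in\exp Y$, $\alpha\in L$; (d) for each $A\in\exp X$ the set $\{(B,\alpha)\in\exp Y\times L\mid(A,B,\alpha)\in R\}$ is closed in $\exp Y\times L$. It is strict if, in addition, for each $B\in\exp Y$ the set $\{(A,\alpha)\in\exp X\times L\mid(A,B,\alpha)\in R\}$ is closed in $\exp X\times L$. For a strict $L$-ambiguous representation $R$, $R^{\cup}\subset\exp^2X\times\exp Y\times L$ is defined by $$R^{\cup}=\bigl\{(\mathcal A,B,\gamma)\mid\mathcal A\in\exp^2X,\ B\in\exp Y,\ \gamma\in L,\ \gamma\le\sup\{\alpha\in L\mid(A,B,\alpha)\in R\text{ for some }A\in\mathcal A\}\bigr\}.$$ This is a closed subset of $\exp^2X\times\exp Y\times L$. *)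

theory Defs
  imports "HOL-Analysis.Analysis" "HOL-Algebra.Lattice"
begin

section \<open>Hyperspaces\<close>

definition exp_set :: "'a topology \<Rightarrow> 'a set set"
  where "exp_set K = {F. closedin K F \<and> F \<noteq> {}}"

definition vietoris_basic :: "'a topology \<Rightarrow> 'a set set \<Rightarrow> 'a set set"
  where "vietoris_basic K \<U> = {F \<in> exp_set K. F \<subseteq> \<Union>\<U> \<and> (\<forall>U\<in>\<U>. F \<inter> U \<noteq> {})}"

definition vietoris :: "'a topology \<Rightarrow> 'a set topology"
  where "vietoris K =
    topology_generated_by {vietoris_basic K \<U> |\<U>. finite \<U> \<and> (\<forall>U\<in>\<U>. openin K U)}"

lemma topspace_vietoris: "topspace (vietoris K) = exp_set K"
proof -
  have "exp_set K \<subseteq> vietoris_basic K {topspace K}"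
    by (auto simp: exp_set_def vietoris_basic_def dest: closedin_subset)
  moreover have "vietoris_basic K \<U> \<subseteq> exp_set K" for \<U>
    by (auto simp: vietoris_basic_def)
  moreover have "openin K (topspace K)"
    by simp
  ultimately have "\<Union>{vietoris_basic K \<U> |\<U>. finite \<U> \<and> (\<forall>U\<in>\<U>. openin K U)} = exp_set K"
    by (intro subset_antisym Union_least subset_trans[OF _ Union_upper[of "vietoris_basic K {topspace K}"]]) auto
  then show ?thesis
    by (simp add: vietoris_def)
qed

text \<open>The generating family is a base of the topology, not just a subbase.\<close>

lemma vietoris_basic_Int:
  "vietoris_basic K \<U> \<inter> vietoris_basic K \<V> =
     vietoris_basic K ((\<lambda>U. U \<inter> \<Union>\<V>) ` \<U> \<union> (\<lambda>V. V \<inter> \<Union>\<U>) ` \<V>)"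
    (is "?L = ?R")
proof (rule Set.set_eqI)
  fix F
  have l: "F \<subseteq> \<Union>((\<lambda>U. U \<inter> \<Union>\<V>) ` \<U> \<union> (\<lambda>V. V \<inter> \<Union>\<U>) ` \<V>) \<longleftrightarrow> F \<subseteq> \<Union>\<U> \<and> F \<subseteq> \<Union>\<V>"
    by blast
  have m: "F \<inter> (U \<inter> W) = F \<inter> U" if "F \<subseteq> W" for U W
    using that by blast
  show "F \<in> ?L \<longleftrightarrow> F \<in> ?R"
    unfolding vietoris_basic_def Int_iff mem_Collect_eq l ball_Un ball_simps
    using m[of "\<Union>\<U>"] m[of "\<Union>\<V>"] by (simp; metis)
qed

lemma openin_vietoris:
  "openin (vietoris K) =
     arbitrary union_of (\<lambda>N. \<exists>\<U>. finite \<U> \<and> (\<forall>U\<in>\<U>. openin K U) \<and> N = vietoris_basic K \<U>)"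
    (is "_ = arbitrary union_of ?P")
proof
  fix S
  have P_Int: "?P (A \<inter> B)" if AB: "?P A" "?P B" for A B
  proof -
    obtain \<U> \<V> where UV: "finite \<U>" "\<forall>U\<in>\<U>. openin K U" "A = vietoris_basic K \<U>"
      "finite \<V>" "\<forall>U\<in>\<V>. openin K U" "B = vietoris_basic K \<V>"
      using AB by metis
    then have "openin K (\<Union>\<U>)" "openin K (\<Union>\<V>)" by auto
    then have "finite ((\<lambda>U. U \<inter> \<Union>\<V>) ` \<U> \<union> (\<lambda>V. V \<inter> \<Union>\<U>) ` \<V>)"
      "\<forall>W \<in> (\<lambda>U. U \<inter> \<Union>\<V>) ` \<U> \<union> (\<lambda>V. V \<inter> \<Union>\<U>) ` \<V>. openin K W"
      using UV by (simp_all add: ball_Un openin_Int)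
    then show ?thesis
      using vietoris_basic_Int[of K \<U> \<V>] UV(3,6) by metis
  qed
  then have top: "istopology (arbitrary union_of ?P)"
    by (rule istopology_base)
  show "openin (vietoris K) S = (arbitrary union_of ?P) S"
  proof
    assume "openin (vietoris K) S"
    then have "generate_topology_on {vietoris_basic K \<U> |\<U>. finite \<U> \<and> (\<forall>U\<in>\<U>. openin K U)} S"
      by (simp add: vietoris_def openin_topology_generated_by_iff)
    then show "(arbitrary union_of ?P) S"
    proof induction
      case Empty
      show ?case by (simp add: arbitrary_union_of_empty)
    next
      case (Int a b)
      then show ?case using top by (auto simp: istopology_def)
    next
      case (UN \<K>)
      then show ?case using arbitrary_union_of_Union by blast
    next
      case (Basis s)
      then show ?case by (intro arbitrary_union_of_inc) auto
    qed
  next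
    assume "(arbitrary union_of ?P) S"
    then obtain \<F> where "\<And>N. N \<in> \<F> \<Longrightarrow> ?P N" "S = \<Union>\<F>"
      by (auto simp: union_of_def)
    moreover have "openin (vietoris K) N" if "?P N" for N
      unfolding vietoris_def using that by (intro topology_generated_by_Basis) auto
    ultimately show "openin (vietoris K) S"
      by blast
  qed
qed


section \<open>Topological semilattices and lattices\<close>

definition topological_upper_semilattice :: "'l topology \<Rightarrow> 'l gorder \<Rightarrow> bool"
  where "topological_upper_semilattice T L \<longleftrightarrow>
    upper_semilattice L \<and> topspace T = carrier L \<and> Hausdorff_space T \<and>
    continuous_map (prod_topology T T) T (\<lambda>(x, y). x \<squnion>\<^bsub>L\<^esub> y)"

definition topological_lower_semilattice :: "'l topology \<Rightarrow> 'l gorder \<Rightarrow> bool"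
  where "topological_lower_semilattice T L \<longleftrightarrow>
    lower_semilattice L \<and> topspace T = carrier L \<and> Hausdorff_space T \<and>
    continuous_map (prod_topology T T) T (\<lambda>(x, y). x \<sqinter>\<^bsub>L\<^esub> y)"

definition upper_subsemilattice :: "'l gorder \<Rightarrow> 'l set \<Rightarrow> bool"
  where "upper_subsemilattice L S \<longleftrightarrow> S \<subseteq> carrier L \<and> (\<forall>x\<in>S. \<forall>y\<in>S. x \<squnion>\<^bsub>L\<^esub> y \<in> S)"

definition lower_subsemilattice :: "'l gorder \<Rightarrow> 'l set \<Rightarrow> bool"
  where "lower_subsemilattice L S \<longleftrightarrow> S \<subseteq> carrier L \<and> (\<forall>x\<in>S. \<forall>y\<in>S. x \<sqinter>\<^bsub>L\<^esub> y \<in> S)"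

text \<open>As usual for Lawson semilattices, members of a local base at a point are neighbourhoods
  of that point that need not be open.\<close>

definition Lawson_upper_semilattice :: "'l topology \<Rightarrow> 'l gorder \<Rightarrow> bool"
  where "Lawson_upper_semilattice T L \<longleftrightarrow>
    topological_upper_semilattice T L \<and>
    (\<forall>x\<in>carrier L. neighbourhood_base_at x (upper_subsemilattice L) T)"

definition Lawson_lower_semilattice :: "'l topology \<Rightarrow> 'l gorder \<Rightarrow> bool"
  where "Lawson_lower_semilattice T L \<longleftrightarrow>
    topological_lower_semilattice T L \<and>
    (\<forall>x\<in>carrier L. neighbourhood_base_at x (lower_subsemilattice L) T)"

definition Lawson_lattice :: "'l topology \<Rightarrow> 'l gorder \<Rightarrow> bool"
  where "Lawson_lattice T L \<longleftrightarrow>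
    lattice L \<and>
    (\<forall>x\<in>carrier L. \<forall>y\<in>carrier L. \<forall>z\<in>carrier L.
      x \<sqinter>\<^bsub>L\<^esub> (y \<squnion>\<^bsub>L\<^esub> z) = (x \<sqinter>\<^bsub>L\<^esub> y) \<squnion>\<^bsub>L\<^esub> (x \<sqinter>\<^bsub>L\<^esub> z)) \<and>
    Lawson_upper_semilattice T L \<and> Lawson_lower_semilattice T L"


section \<open>Ambiguous representations\<close>

definition ambiguous_representation ::
    "'a topology \<Rightarrow> 'b topology \<Rightarrow> 'l topology \<Rightarrow> 'l gorder \<Rightarrow> ('a set \<times> 'b set \<times> 'l) set \<Rightarrow> bool"
  where "ambiguous_representation X Y T L R \<longleftrightarrow>
    R \<subseteq> exp_set X \<times> exp_set Y \<times> carrier L \<and>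
    (\<forall>A\<in>exp_set X. \<forall>A'\<in>exp_set X. \<forall>B\<in>exp_set Y. \<forall>B'\<in>exp_set Y. \<forall>\<alpha>\<in>carrier L. \<forall>\<alpha>'\<in>carrier L.
      A' \<subseteq> A \<and> B \<subseteq> B' \<and> \<alpha>' \<sqsubseteq>\<^bsub>L\<^esub> \<alpha> \<and> (A, B, \<alpha>) \<in> R \<longrightarrow> (A', B', \<alpha>') \<in> R) \<and>
    (\<forall>A B \<alpha> \<beta>. (A, B, \<alpha>) \<in> R \<and> (A, B, \<beta>) \<in> R \<longrightarrow> (A, B, \<alpha> \<squnion>\<^bsub>L\<^esub> \<beta>) \<in> R) \<and>
    (\<forall>A\<in>exp_set X. \<forall>B\<in>exp_set Y. \<forall>\<alpha>\<in>carrier L.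
      (A, topspace Y, \<alpha>) \<in> R \<and> (A, B, \<bottom>\<^bsub>L\<^esub>) \<in> R) \<and>
    (\<forall>A\<in>exp_set X. closedin (prod_topology (vietoris Y) T) {(B, \<alpha>). (A, B, \<alpha>) \<in> R})"

definition strict_ambiguous_representation ::
    "'a topology \<Rightarrow> 'b topology \<Rightarrow> 'l topology \<Rightarrow> 'l gorder \<Rightarrow> ('a set \<times> 'b set \<times> 'l) set \<Rightarrow> bool"
  where "strict_ambiguous_representation X Y T L R \<longleftrightarrow>
    ambiguous_representation X Y T L R \<and>
    (\<forall>B\<in>exp_set Y. closedin (prod_topology (vietoris X) T) {(A, \<alpha>). (A, B, \<alpha>) \<in> R})"

definition CSAmb ::
    "'a topology \<Rightarrow> 'b topology \<Rightarrow> 'l topology \<Rightarrow> 'l gorder \<Rightarrow> ('a set \<times> 'b set \<times> 'l) set gorder"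
  where "CSAmb X Y T L =
    \<lparr>carrier = {R. strict_ambiguous_representation X Y T L R}, eq = (=), le = (\<subseteq>)\<rparr>"

definition rep_cup ::
    "'a topology \<Rightarrow> 'b topology \<Rightarrow> 'l gorder \<Rightarrow> ('a set \<times> 'b set \<times> 'l) set
      \<Rightarrow> ('a set set \<times> 'b set \<times> 'l) set"
  where "rep_cup X Y L R =
    {(\<A>, B, \<gamma>). \<A> \<in> exp_set (vietoris X) \<and> B \<in> exp_set Y \<and> \<gamma> \<in> carrier L \<and>
      \<gamma> \<sqsubseteq>\<^bsub>L\<^esub> \<Squnion>\<^bsub>L\<^esub> {\<alpha> \<in> carrier L. \<exists>A\<in>\<A>. (A, B, \<alpha>) \<in> R}}"

definition cup_hyperspace ::
    "'a topology \<Rightarrow> 'b topology \<Rightarrow> 'l topology \<Rightarrow> ('a set set \<times> 'b set \<times> 'l) set topology"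
  where "cup_hyperspace X Y T =
    vietoris (prod_topology (vietoris (vietoris X)) (prod_topology (vietoris Y) T))"

text \<open>The only topology on the set of strict representations that can make
  \<open>rep_cup\<close> an embedding is the initial one. That it does so is not part of the definition.\<close>

definition CSAmb_topology ::
    "'a topology \<Rightarrow> 'b topology \<Rightarrow> 'l topology \<Rightarrow> 'l gorder \<Rightarrow> ('a set \<times> 'b set \<times> 'l) set topology"
  where "CSAmb_topology X Y T L =
    pullback_topology (carrier (CSAmb X Y T L)) (rep_cup X Y L) (cup_hyperspace X Y T)"

end

(* Write r(A, B) for the greatest alpha with (A, B, alpha) in R. For c in L and open sets U of exp X
   and V of Y (V not all of Y), the largest R with r(A, B) <= c whenever A in U and B <= V is an
   explicit strict representation ("capped U V c"). In the topology induced by the Vietoris topology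
   of the sets R^cup, the hit-sets reduce to conditions "R is not contained in capped U V c", and the
   miss-sets reduce to "R is disjoint from K" with K closed in exp X * exp Y * L. Thus no limit of
   representations has to be computed: the representations are closed under intersections, and the
   topology is that of a dually continuous lattice. Compactness follows from Alexander's subbase
   theorem, and each avoidance condition at R can be relaxed to "contained in S" for one strict
   representation S, a condition stable under joins. The Lawson property of L enters through
   interpolation: if gamma is not below s, then some c has s in the interior of its down-set and is
   still not above gamma. *)

theory Submission
  imports Defs
begin

text \<open>Two obstacles shape the argument. Strictness gives only separate closedness of R, in
  \<open>(B, \<alpha>)\<close> for fixed \<open>A\<close> and in \<open>(A, \<alpha>)\<close> for
  fixed \<open>B\<close>; control over all three coordinates at once has to be won from
  monotonicity, and every miss condition passes through this. The hit conditions show what the step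
  to \<open>exp (exp X)\<close> buys. Finitely many triples \<open>(A_i, B_i, \<alpha>_i)\<close> of
  R cannot be merged inside R, because enlarging \<open>A_i\<close> may lose values. In R^cup the
  \<open>A_i\<close> become members of one element of \<open>exp (exp X)\<close>, the
  \<open>B_i\<close> are united, and the supremum of the \<open>\<alpha>_i\<close> is available.
  Hence one open box can be traded for finitely many bounds \<open>c\<close>. The way back from
  R^cup to R uses singletons \<open>{A}\<close>. Caps need \<open>V\<close> proper because at
  \<open>B = Y\<close> every value is prescribed. Joins are used only through their order property:
  for a representation \<open>H\<close>, a join is contained in \<open>H\<close> iff both parts are.
  So failure to lie in a cap splits over a join, and containment in \<open>S\<close> is inherited by
  it.\<close>

text \<open>\<open>Alexander_subbase\<close> wants the topology as the one literally generated by
  the subbase; a local condition at each point replaces that equation here. The intersection with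
  \<open>topspace X\<close> covers the case of an empty \<open>\<F>\<close>.\<close>

lemma compact_space_subbaseI:
  assumes top: "\<Union>\<B> = topspace X"
    and op: "\<And>B. B \<in> \<B> \<Longrightarrow> openin X B"
    and sub: "\<And>W x. \<lbrakk>openin X W; x \<in> W\<rbrakk> \<Longrightarrow>
      \<exists>\<F>. finite \<F> \<and> \<F> \<subseteq> \<B> \<and> x \<in> \<Inter>\<F> \<and> topspace X \<inter> \<Inter>\<F> \<subseteq> W"
    and fin: "\<And>\<C>. \<lbrakk>\<C> \<subseteq> \<B>; \<Union>\<C> = topspace X\<rbrakk> \<Longrightarrow> \<exists>\<C>'. finite \<C>' \<and> \<C>' \<subseteq> \<C> \<and> \<Union>\<C>' = topspace X"
  shows "compact_space X"
proof (rule Alexander_subbase)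
  let ?P = "finite intersection_of (\<lambda>x. x \<in> \<B>) relative_to \<Union>\<B>"
  have "openin X = arbitrary union_of ?P"
    unfolding openin_topology_base_unique
  proof (intro conjI allI impI)
    fix V assume "?P V"
    then obtain \<F> where "finite \<F>" "\<F> \<subseteq> \<B>" "V = topspace X \<inter> \<Inter>\<F>"
      unfolding relative_to_def intersection_of_def top by auto
    then show "openin X V"
      using op by (metis openin_Int_Inter openin_topspace subsetD)
  next
    fix W x assume "openin X W \<and> x \<in> W"
    then obtain \<F> where F: "finite \<F>" "\<F> \<subseteq> \<B>" "x \<in> \<Inter>\<F>" "topspace X \<inter> \<Inter>\<F> \<subseteq> W" "x \<in> topspace X"
      using sub openin_subset by (metis subsetD)
    then have "?P (topspace X \<inter> \<Inter>\<F>)"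
      unfolding relative_to_def intersection_of_def top by auto
    then show "\<exists>V. ?P V \<and> x \<in> V \<and> V \<subseteq> W"
      using F by auto
  qed
  then show "topology (arbitrary union_of ?P) = X"
    by (metis openin_inverse)
qed (rule fin)

section \<open>The Vietoris topology\<close>

lemma exp_set_iff: "F \<in> exp_set K \<longleftrightarrow> closedin K F \<and> F \<noteq> {}"
  by (simp add: exp_set_def)

lemma exp_set_Un: "\<lbrakk>F \<in> exp_set K; G \<in> exp_set K\<rbrakk> \<Longrightarrow> F \<union> G \<in> exp_set K"
  by (auto simp: exp_set_def)

lemma topspace_in_exp_set: "topspace K \<noteq> {} \<Longrightarrow> topspace K \<in> exp_set K"
  by (simp add: exp_set_def)

lemma sing_in_exp_set: "\<lbrakk>Hausdorff_space K; x \<in> topspace K\<rbrakk> \<Longrightarrow> {x} \<in> exp_set K"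
  by (simp add: exp_set_def closedin_Hausdorff_sing_eq)

lemma finite_in_exp_set: "\<lbrakk>Hausdorff_space K; finite F; F \<subseteq> topspace K; F \<noteq> {}\<rbrakk> \<Longrightarrow> F \<in> exp_set K"
  by (simp add: exp_set_def closedin_Hausdorff_finite_eq)

lemma openin_vietoris_basic:
  "\<lbrakk>finite \<U>; \<And>U. U \<in> \<U> \<Longrightarrow> openin K U\<rbrakk> \<Longrightarrow> openin (vietoris K) (vietoris_basic K \<U>)"
  unfolding vietoris_def by (intro topology_generated_by_Basis) auto

lemma openin_vietoris_subset:
  assumes "openin K U" shows "openin (vietoris K) {F \<in> exp_set K. F \<subseteq> U}"
proof -
  have "{F \<in> exp_set K. F \<subseteq> U} = vietoris_basic K {U}"
    by (auto simp: vietoris_basic_def exp_set_def)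
  then show ?thesis using openin_vietoris_basic[of "{U}" K] assms by simp
qed

lemma openin_vietoris_meets:
  assumes "openin K U" shows "openin (vietoris K) {F \<in> exp_set K. F \<inter> U \<noteq> {}}"
proof -
  have "{F \<in> exp_set K. F \<inter> U \<noteq> {}} = vietoris_basic K {topspace K, U}"
    using closedin_subset unfolding vietoris_basic_def exp_set_def by fastforce
  moreover have "openin (vietoris K) (vietoris_basic K {topspace K, U})"
    using assms by (intro openin_vietoris_basic) auto
  ultimately show ?thesis by metis
qed

lemma closedin_vietoris_subset:
  assumes "closedin K D" shows "closedin (vietoris K) {F \<in> exp_set K. F \<subseteq> D}"
proof -
  have "exp_set K - {F \<in> exp_set K. F \<subseteq> D} = {F \<in> exp_set K. F \<inter> (topspace K - D) \<noteq> {}}"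
    using closedin_subset unfolding exp_set_def by fastforce
  then show ?thesis
    using openin_vietoris_meets[of K "topspace K - D"] assms
    by (simp add: closedin_def topspace_vietoris openin_diff)
qed

lemma vietoris_basic_nbhd:
  assumes "openin (vietoris K) \<W>" "F \<in> \<W>"
  obtains \<U> where "finite \<U>" "\<And>U. U \<in> \<U> \<Longrightarrow> openin K U" "F \<in> vietoris_basic K \<U>" "vietoris_basic K \<U> \<subseteq> \<W>"
proof -
  obtain \<N> where "\<And>N. N \<in> \<N> \<Longrightarrow> \<exists>\<U>. finite \<U> \<and> (\<forall>U\<in>\<U>. openin K U) \<and> N = vietoris_basic K \<U>" "\<W> = \<Union>\<N>"
    using assms(1) unfolding openin_vietoris union_of_def by auto
  then show thesis
    using that assms(2) by (metis Union_iff Union_upper)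
qed

text \<open>In a cover by sets \<open>?m U\<close> and \<open>?s V\<close>, let \<open>C\<close> be
  what the available \<open>U\<close> leave uncovered. If non-empty, \<open>C\<close> is itself a
  point of the hyperspace lying in no \<open>?m U\<close>, so some \<open>?s V\<close> contains it;
  the compact rest outside \<open>V\<close> then needs only finitely many \<open>U\<close>. The
  compactness proof for \<open>\<tau>\<close> follows the same pattern.\<close>

lemma compact_space_vietoris:
  assumes K: "compact_space K" shows "compact_space (vietoris K)"
proof (rule compact_space_subbaseI)
  let ?m = "\<lambda>U. {F \<in> exp_set K. F \<inter> U \<noteq> {}}" and ?s = "\<lambda>U. {F \<in> exp_set K. F \<subseteq> U}"
  let ?\<B> = "?m ` Collect (openin K) \<union> ?s ` Collect (openin K)"
  have "?s (topspace K) = exp_set K"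
    using closedin_subset by (fastforce simp: exp_set_def)
  then have "exp_set K \<in> ?\<B>"
    using image_eqI[of "exp_set K" ?s "topspace K"] by blast
  moreover have "B \<subseteq> exp_set K" if "B \<in> ?\<B>" for B
    using that by auto
  ultimately show "\<Union>?\<B> = topspace (vietoris K)"
    unfolding topspace_vietoris by (meson Sup_least Union_upper subset_antisym)
  show "openin (vietoris K) B" if "B \<in> ?\<B>" for B
    using that openin_vietoris_subset openin_vietoris_meets by auto
  show "\<exists>\<F>. finite \<F> \<and> \<F> \<subseteq> ?\<B> \<and> F \<in> \<Inter>\<F> \<and> topspace (vietoris K) \<inter> \<Inter>\<F> \<subseteq> W"
    if W: "openin (vietoris K) W" "F \<in> W" for W F
  proof -
    obtain \<U> where U: "finite \<U>" "\<And>U. U \<in> \<U> \<Longrightarrow> openin K U" "F \<in> vietoris_basic K \<U>"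
      "vietoris_basic K \<U> \<subseteq> W"
      using vietoris_basic_nbhd W by metis
    let ?\<F> = "insert (?s (\<Union>\<U>)) (?m ` \<U>)"
    have op: "openin K (\<Union>\<U>)" using U(2) by blast
    have eq: "topspace (vietoris K) \<inter> \<Inter>?\<F> = vietoris_basic K \<U>"
      unfolding vietoris_basic_def topspace_vietoris by auto
    show ?thesis
    proof (intro exI[of _ ?\<F>] conjI)
      have "?s (\<Union>\<U>) \<in> ?s ` Collect (openin K)"
        using op by (intro imageI CollectI)
      moreover have "?m ` \<U> \<subseteq> ?m ` Collect (openin K)"
        using U(2) by (intro image_mono) blast
      ultimately show "?\<F> \<subseteq> ?\<B>"
        by (meson Un_iff insert_subset le_supI1)
      show "F \<in> \<Inter>?\<F>"
        using U(3) unfolding eq[symmetric] by (rule IntD2)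
      show "topspace (vietoris K) \<inter> \<Inter>?\<F> \<subseteq> W"
        unfolding eq by (rule U(4))
    qed (simp add: U(1))
  qed
  fix \<C> assume \<C>: "\<C> \<subseteq> ?\<B>" "\<Union>\<C> = topspace (vietoris K)"
  define \<U> where "\<U> = {U. openin K U \<and> ?m U \<in> \<C>}"
  define C where "C = topspace K - \<Union>\<U>"
  have clC: "closedin K C" unfolding C_def \<U>_def by blast
  have "\<exists>\<C>'. finite \<C>' \<and> \<C>' \<subseteq> \<C> \<and> exp_set K \<subseteq> \<Union>\<C>'"
  proof (cases "C = {}")
    case True
    then have "topspace K \<subseteq> \<Union>\<U>" unfolding C_def by auto
    then obtain \<F> where F: "finite \<F>" "\<F> \<subseteq> \<U>" "topspace K \<subseteq> \<Union>\<F>"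
      using K unfolding compact_space_alt \<U>_def by (metis (lifting) mem_Collect_eq)
    have "exp_set K \<subseteq> \<Union>(?m ` \<F>)"
    proof
      fix G assume G: "G \<in> exp_set K"
      then obtain x where "x \<in> G" "x \<in> topspace K"
        by (metis closedin_subset equals0I exp_set_iff subsetD)
      then show "G \<in> \<Union>(?m ` \<F>)" using F(3) G by blast
    qed
    then show ?thesis using F unfolding \<U>_def
      by (intro exI[of _ "?m ` \<F>"]) blast
  next
    case False
    then have "C \<in> exp_set K" using clC by (simp add: exp_set_iff)
    then obtain B where B: "C \<in> B" "B \<in> \<C>" using \<C>(2) topspace_vietoris by (metis Union_iff)
    have nm: "B \<noteq> ?m U" if "openin K U" for U
    proof
      assume BU: "B = ?m U"
      then have "U \<in> \<U>" using that B(2) unfolding \<U>_def by simp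
      then have "C \<inter> U = {}" unfolding C_def by auto
      then show False using B(1) unfolding BU by simp
    qed
    from B(2) have "B \<in> ?\<B>" by (rule subsetD[OF \<C>(1)])
    with nm obtain V where V: "openin K V" "B = ?s V"
      by (auto simp only: Un_iff image_iff mem_Collect_eq)
    have "compactin K (topspace K - V)"
      using V K by (intro closedin_compact_space) auto
    moreover have "topspace K - V \<subseteq> \<Union>\<U>" using B V unfolding C_def by blast
    ultimately obtain \<F> where F: "finite \<F>" "\<F> \<subseteq> \<U>" "topspace K - V \<subseteq> \<Union>\<F>"
      using compactinD[of K "topspace K - V" \<U>] unfolding \<U>_def by blast
    have "exp_set K \<subseteq> \<Union>(insert B (?m ` \<F>))"
    proof
      fix G assume G: "G \<in> exp_set K"
      then have "G \<subseteq> topspace K" by (simp add: closedin_subset exp_set_iff)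
      then show "G \<in> \<Union>(insert B (?m ` \<F>))" using F(3) G V(2) by (cases "G \<subseteq> V") auto
    qed
    then show ?thesis using F B unfolding \<U>_def
      by (intro exI[of _ "insert B (?m ` \<F>)"]) blast
  qed
  then show "\<exists>\<C>'. finite \<C>' \<and> \<C>' \<subseteq> \<C> \<and> \<Union>\<C>' = topspace (vietoris K)"
    using \<C>(2) unfolding topspace_vietoris by (metis Union_mono subset_antisym)
qed

lemma Hausdorff_space_vietoris:
  assumes K: "compact_space K" "Hausdorff_space K" shows "Hausdorff_space (vietoris K)"
proof -
  \<comment> \<open>The separation is asymmetric: \<open>F\<close> is caught by hitting
    \<open>U\<close>, while \<open>G\<close> is caught by lying inside \<open>V\<close>.\<close>
  have sep: "\<exists>U V. openin (vietoris K) U \<and> openin (vietoris K) V \<and> F \<in> U \<and> G \<in> V \<and> disjnt U V"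
    if FG: "F \<in> exp_set K" "G \<in> exp_set K" "x \<in> F" "x \<notin> G" for F G x
  proof -
    have "x \<in> topspace K" using FG closedin_subset by (fastforce simp: exp_set_iff)
    moreover have "compactin K G" using FG K by (simp add: closedin_compact_space exp_set_iff)
    ultimately obtain U V where UV: "openin K U" "openin K V" "{x} \<subseteq> U" "G \<subseteq> V" "disjnt U V"
      using Hausdorff_space_compact_separation[OF K(2), of "{x}" G] FG by auto
    then show ?thesis using FG
      by (intro exI[of _ "{F \<in> exp_set K. F \<inter> U \<noteq> {}}"] exI[of _ "{F \<in> exp_set K. F \<subseteq> V}"])
        (auto simp: openin_vietoris_subset openin_vietoris_meets disjnt_def)
  qed
  show ?thesis
    unfolding Hausdorff_space_def topspace_vietoris
  proof (intro allI impI)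
    fix F G assume *: "F \<in> exp_set K \<and> G \<in> exp_set K \<and> F \<noteq> G"
    then consider x where "x \<in> F" "x \<notin> G" | x where "x \<in> G" "x \<notin> F" by blast
    then show "\<exists>U V. openin (vietoris K) U \<and> openin (vietoris K) V \<and> F \<in> U \<and> G \<in> V \<and> disjnt U V"
      by cases (use sep[of F G] sep[of G F] * disjnt_sym in metis)+
  qed
qed

text \<open>Enlarging \<open>B\<close> keeps the hit conditions of a basic set, and normality keeps
  the enlargement inside its union. The gain is a single \<open>D\<close> that dominates all
  \<open>B'\<close> inside \<open>V\<close>, so that monotonicity in the second coordinate can be
  applied to a whole neighbourhood at once.\<close>

lemma vietoris_closed_nbhd:
  assumes K: "compact_space K" "Hausdorff_space K" and W: "openin (vietoris K) \<W>" "B \<in> \<W>"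
  obtains V D where "openin K V" "closedin K D" "B \<subseteq> V" "V \<subseteq> D" "D \<in> \<W>"
proof -
  obtain \<U> where U: "finite \<U>" "\<And>U. U \<in> \<U> \<Longrightarrow> openin K U" "B \<in> vietoris_basic K \<U>"
    "vietoris_basic K \<U> \<subseteq> \<W>"
    using vietoris_basic_nbhd W by metis
  have B: "closedin K B" "B \<subseteq> \<Union>\<U>" "B \<noteq> {}"
    using U(3) by (auto simp: vietoris_basic_def exp_set_def)
  have "openin K (\<Union>\<U>)" using U(2) by blast
  moreover have "normal_space K" using K by (simp add: compact_Hausdorff_or_regular_imp_normal_space)
  ultimately obtain V where V: "openin K V" "B \<subseteq> V" "K closure_of V \<subseteq> \<Union>\<U>"
    using B unfolding normal_space_alt by metis
  have VD: "V \<subseteq> K closure_of V" using V(1) by (simp add: closure_of_subset openin_subset)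
  have "K closure_of V \<in> vietoris_basic K \<U>"
    unfolding vietoris_basic_def mem_Collect_eq exp_set_iff
  proof (intro conjI ballI)
    show "K closure_of V \<inter> U \<noteq> {}" if "U \<in> \<U>" for U
      using that U(3) V(2) VD unfolding vietoris_basic_def by blast
  qed (use V B VD in auto)
  then show thesis using that[OF V(1) _ V(2) VD] U(4) by auto
qed

text \<open>Choosing one point in each set that is hit gives a finite subset of \<open>F'\<close>
  which already lies in the basic neighbourhood of \<open>G\<close>. The result makes the complement
  of a capped representation open.\<close>

lemma openin_vietoris_supsets:
  assumes K: "Hausdorff_space K" and U: "openin (vietoris K) \<U>"
  shows "openin (vietoris K) {F \<in> exp_set K. \<exists>G\<in>\<U>. G \<subseteq> F}"
proof (subst openin_subopen, intro ballI)
  fix F assume "F \<in> {F \<in> exp_set K. \<exists>G\<in>\<U>. G \<subseteq> F}"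
  then obtain G where F: "F \<in> exp_set K" and G: "G \<in> \<U>" "G \<subseteq> F" by blast
  obtain \<V> where V: "finite \<V>" "\<And>U. U \<in> \<V> \<Longrightarrow> openin K U" "G \<in> vietoris_basic K \<V>"
    "vietoris_basic K \<V> \<subseteq> \<U>"
    using vietoris_basic_nbhd[OF U G(1)] by metis
  have FK: "F \<subseteq> topspace K" using F by (simp add: closedin_subset exp_set_iff)
  \<comment> \<open>Inserting \<open>topspace K\<close> cancels the containment condition and leaves
    only the hit conditions, as \<open>F\<close> may reach outside the union of
    \<open>\<V>\<close>.\<close>
  let ?W = "vietoris_basic K (insert (topspace K) \<V>)"
  have "F \<inter> topspace K \<noteq> {}" using F FK by (auto simp: exp_set_def)
  moreover have "F \<inter> U \<noteq> {}" if "U \<in> \<V>" for U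
    using that V(3) G(2) unfolding vietoris_basic_def by blast
  ultimately have "F \<in> ?W" using F FK by (auto simp: vietoris_basic_def)
  moreover have "openin (vietoris K) ?W"
    using V(1,2) by (intro openin_vietoris_basic) auto
  moreover have "\<exists>G\<in>\<U>. G \<subseteq> F'" if F': "F' \<in> ?W" for F'
  proof -
    have "\<forall>U\<in>\<V>. \<exists>x. x \<in> F' \<inter> U" using F' by (auto simp: vietoris_basic_def)
    then obtain x where x: "\<And>U. U \<in> \<V> \<Longrightarrow> x U \<in> F' \<inter> U" by metis
    have "\<V> \<noteq> {}" using V(3) by (auto simp: vietoris_basic_def exp_set_def)
    moreover have "F' \<subseteq> topspace K" using F' closedin_subset by (auto simp: vietoris_basic_def exp_set_def)
    ultimately have "x ` \<V> \<in> exp_set K"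
      using x V(1) by (intro finite_in_exp_set[OF K]) auto
    then have "x ` \<V> \<in> vietoris_basic K \<V>"
      using x unfolding vietoris_basic_def by auto
    then show ?thesis using V(4) x by blast
  qed
  moreover have "?W \<subseteq> exp_set K" by (auto simp: vietoris_basic_def)
  ultimately show "\<exists>T. openin (vietoris K) T \<and> F \<in> T \<and> T \<subseteq> {F \<in> exp_set K. \<exists>G\<in>\<U>. G \<subseteq> F}"
    by (intro exI[of _ ?W]) auto
qed

lemma continuous_map_vietoris_sing:
  assumes "Hausdorff_space K" shows "continuous_map K (vietoris K) (\<lambda>x. {x})"
  unfolding continuous_map_alt
proof (intro conjI allI impI)
  show "(\<lambda>x. {x}) \<in> topspace K \<rightarrow> topspace (vietoris K)"
    by (simp add: topspace_vietoris sing_in_exp_set assms)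
  fix W assume W: "openin (vietoris K) W"
  show "openin K ((\<lambda>x. {x}) -` W \<inter> topspace K)"
  proof (subst openin_subopen, intro ballI)
    fix x assume x: "x \<in> (\<lambda>x. {x}) -` W \<inter> topspace K"
    then have "{x} \<in> W" by simp
    then obtain \<U> where U: "finite \<U>" "\<And>U. U \<in> \<U> \<Longrightarrow> openin K U" "{x} \<in> vietoris_basic K \<U>"
      "vietoris_basic K \<U> \<subseteq> W"
      using vietoris_basic_nbhd[OF W] by metis
    have "openin K (topspace K \<inter> \<Inter>\<U>)"
      using U(1,2) by (intro openin_Int_Inter) auto
    moreover have "{y} \<in> vietoris_basic K \<U>" if "y \<in> topspace K \<inter> \<Inter>\<U>" for y
      using that U(3) assms sing_in_exp_set[of K y] by (auto simp: vietoris_basic_def)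
    moreover have "x \<in> topspace K \<inter> \<Inter>\<U>" using x U(3) by (auto simp: vietoris_basic_def)
    ultimately show "\<exists>T. openin K T \<and> x \<in> T \<and> T \<subseteq> (\<lambda>x. {x}) -` W \<inter> topspace K"
      using U(4) by (intro exI[of _ "topspace K \<inter> \<Inter>\<U>"]) auto
  qed
qed

section \<open>Compact Lawson semilattices\<close>

locale compact_Lawson_lattice = Lattice.lattice L for L :: "'l gorder" (structure) +
  fixes T :: "'l topology"
  assumes compact: "compact_space T"
    and nonempty: "carrier L \<noteq> {}"
    and upper: "Lawson_upper_semilattice T L"
    and lower: "topological_lower_semilattice T L"
begin

lemma topspace_T [simp]: "topspace T = carrier L"
  using upper by (simp add: Lawson_upper_semilattice_def topological_upper_semilattice_def)

lemma Hausdorff_T: "Hausdorff_space T"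
  using upper by (simp add: Lawson_upper_semilattice_def topological_upper_semilattice_def)

lemma continuous_join_right: "a \<in> carrier L \<Longrightarrow> continuous_map T T (\<lambda>x. x \<squnion> a)"
proof -
  assume a: "a \<in> carrier L"
  have "continuous_map T (prod_topology T T) (\<lambda>x. (x, a))"
    using a by (simp add: continuous_map_pairwise o_def)
  moreover have "continuous_map (prod_topology T T) T (\<lambda>(x, y). x \<squnion> y)"
    using upper by (simp add: Lawson_upper_semilattice_def topological_upper_semilattice_def)
  ultimately have "continuous_map T T ((\<lambda>(x, y). x \<squnion> y) \<circ> (\<lambda>x. (x, a)))"
    by (rule continuous_map_compose)
  then show ?thesis by (simp add: o_def)
qed

lemma continuous_meet_right: "a \<in> carrier L \<Longrightarrow> continuous_map T T (\<lambda>x. x \<sqinter> a)"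
proof -
  assume a: "a \<in> carrier L"
  have "continuous_map T (prod_topology T T) (\<lambda>x. (x, a))"
    using a by (simp add: continuous_map_pairwise o_def)
  moreover have "continuous_map (prod_topology T T) T (\<lambda>(x, y). x \<sqinter> y)"
    using lower by (simp add: topological_lower_semilattice_def)
  ultimately have "continuous_map T T ((\<lambda>(x, y). x \<sqinter> y) \<circ> (\<lambda>x. (x, a)))"
    by (rule continuous_map_compose)
  then show ?thesis by (simp add: o_def)
qed

section \<open>Order and topology of a compact topological lattice\<close>

lemma le_iff_join_eq: "\<lbrakk>x \<in> carrier L; y \<in> carrier L\<rbrakk> \<Longrightarrow> x \<sqsubseteq> y \<longleftrightarrow> x \<squnion> y = y"
  using join_left[of x y] join_right[of x y] join_le[of x y y] le_antisym[of "x \<squnion> y" y] by auto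

lemma le_iff_meet_eq: "\<lbrakk>x \<in> carrier L; y \<in> carrier L\<rbrakk> \<Longrightarrow> x \<sqsubseteq> y \<longleftrightarrow> y \<sqinter> x = x"
  using meet_left[of y x] meet_right[of y x] meet_le[of x y x] le_antisym[of "y \<sqinter> x" x] by auto

lemma closedin_le: "c \<in> carrier L \<Longrightarrow> closedin T {x \<in> carrier L. x \<sqsubseteq> c}"
proof -
  assume c: "c \<in> carrier L"
  have "closedin T {x \<in> topspace T. x \<squnion> c \<in> {c}}"
    using c Hausdorff_T
    by (intro closedin_continuous_map_preimage[OF continuous_join_right]) (simp_all add: closedin_Hausdorff_sing_eq)
  then show ?thesis using c by (simp add: le_iff_join_eq cong: conj_cong)
qed

lemma closedin_ge: "c \<in> carrier L \<Longrightarrow> closedin T {x \<in> carrier L. c \<sqsubseteq> x}"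
proof -
  assume c: "c \<in> carrier L"
  have "closedin T {x \<in> topspace T. x \<sqinter> c \<in> {c}}"
    using c Hausdorff_T
    by (intro closedin_continuous_map_preimage[OF continuous_meet_right]) (simp_all add: closedin_Hausdorff_sing_eq)
  then show ?thesis using c by (simp add: le_iff_meet_eq cong: conj_cong)
qed

lemma openin_not_le: "c \<in> carrier L \<Longrightarrow> openin T {x \<in> carrier L. \<not> x \<sqsubseteq> c}"
  using closedin_le[of c] by (simp add: closedin_def set_diff_eq cong: conj_cong)

lemma least_Upper_iff:
  assumes "A \<subseteq> carrier L"
  shows "least L s (Upper L A) \<longleftrightarrow>
    s \<in> carrier L \<and> (\<forall>a\<in>A. a \<sqsubseteq> s) \<and> (\<forall>u\<in>carrier L. (\<forall>a\<in>A. a \<sqsubseteq> u) \<longrightarrow> s \<sqsubseteq> u)"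
proof -
  have "Upper L A = {u \<in> carrier L. \<forall>a\<in>A. a \<sqsubseteq> u}" using assms by (auto simp: Upper_def)
  then show ?thesis by (auto simp: least_def)
qed

text \<open>The supremum is the limit of the finite joins, found without nets: \<open>C\<close>, the
  up-sets of the members of \<open>V\<close> and the down-sets of its upper bounds are closed, and
  finitely many of them share the join of a finite part of \<open>V\<close>. A common point of all
  is the supremum and lies in \<open>C\<close>.\<close>

lemma least_in_closed:
  assumes V: "V \<subseteq> carrier L" "V \<noteq> {}"
    and C: "closedin T C" "\<And>F. \<lbrakk>finite F; F \<noteq> {}; F \<subseteq> V\<rbrakk> \<Longrightarrow> \<exists>s\<in>C. least L s (Upper L F)"
  shows "\<exists>p\<in>C. least L p (Upper L V)"
proof -
  define up dn where "up = (\<lambda>a. {x \<in> carrier L. a \<sqsubseteq> x})" and "dn = (\<lambda>a. {x \<in> carrier L. x \<sqsubseteq> a})"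
  define B where "B = {u \<in> carrier L. \<forall>a\<in>V. a \<sqsubseteq> u}"
  obtain v where v: "v \<in> V" using V by blast
  have "\<Inter>(insert C (up ` V \<union> dn ` B)) \<noteq> {}"
  proof (rule compact_space_fip[THEN iffD1, OF compact, rule_format], intro conjI ballI allI impI)
    fix D assume "D \<in> insert C (up ` V \<union> dn ` B)"
    then consider "D = C" | a where "a \<in> V" "D = up a" | a where "a \<in> B" "D = dn a" by blast
    then show "closedin T D"
      using closedin_le closedin_ge C(1) V unfolding up_def dn_def B_def by cases auto
  next
    fix \<G> assume G: "finite \<G> \<and> \<G> \<subseteq> insert C (up ` V \<union> dn ` B)"
    then have "finite (\<G> \<inter> up ` V)" "\<G> \<inter> up ` V \<subseteq> up ` V" by auto
    then obtain F where F: "finite F" "F \<subseteq> V" "\<G> \<inter> up ` V = up ` F"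
      by (metis finite_subset_image)
    \<comment> \<open>The extra element \<open>v\<close> keeps the finite set non-empty when
      \<open>\<G>\<close> contains no up-set.\<close>
    then obtain s where s: "s \<in> C" "least L s (Upper L (insert v F))"
      using C(2)[of "insert v F"] v by auto
    have "insert v F \<subseteq> carrier L" using F v V by auto
    from s(2) have s': "s \<in> carrier L" "\<And>a. a \<in> F \<Longrightarrow> a \<sqsubseteq> s" "\<And>u. u \<in> B \<Longrightarrow> s \<sqsubseteq> u"
      unfolding least_Upper_iff[OF \<open>insert v F \<subseteq> carrier L\<close>] B_def using F(2) v by blast+
    have "s \<in> D" if D: "D \<in> \<G>" for D
    proof -
      consider "D = C" | "D \<in> up ` F" | "D \<in> dn ` B" using G D F(3) by blast
      then show ?thesis using s(1) s' unfolding up_def dn_def by cases auto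
    qed
    then show "\<Inter>\<G> \<noteq> {}" by blast
  qed
  then obtain p where p: "p \<in> C" "\<And>v. v \<in> V \<Longrightarrow> p \<in> up v" "\<And>u. u \<in> B \<Longrightarrow> p \<in> dn u" by auto
  then have "least L p (Upper L V)"
    using v unfolding least_Upper_iff[OF V(1)] up_def dn_def B_def by blast
  then show ?thesis using p(1) by blast
qed

text \<open>Finite joins of elements of \<open>V\<close> remain in \<open>V\<close>, hence in
  \<open>C\<close>. With a strictly larger \<open>C\<close> this bounds a subsemilattice in
  \<open>interpolate\<close>; with \<open>C = V\<close> it gives the greatest value of R at a pair
  \<open>(A, B)\<close>.\<close>

lemma sup_in_closed:
  assumes V: "V \<subseteq> carrier L" "V \<noteq> {}" "\<And>x y. \<lbrakk>x \<in> V; y \<in> V\<rbrakk> \<Longrightarrow> x \<squnion> y \<in> V"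
    and C: "closedin T C" "V \<subseteq> C"
  shows "\<exists>p\<in>C. least L p (Upper L V)"
proof (rule least_in_closed[OF V(1,2) C(1)])
  have "\<exists>s\<in>V. least L s (Upper L F)" if "finite F" "F \<noteq> {}" "F \<subseteq> V" for F
    using that
  proof (induction rule: finite_ne_induct)
    case (singleton x)
    then have "least L x (Upper L {x})"
      using V(1) by (subst least_Upper_iff) auto
    then show ?case using singleton by blast
  next
    case (insert x F)
    then obtain s where s: "s \<in> V" "least L s (Upper L F)" by auto
    have c: "F \<subseteq> carrier L" "x \<in> carrier L" "s \<in> carrier L" "insert x F \<subseteq> carrier L"
      using insert V s by auto
    have l: "a \<sqsubseteq> s" if "a \<in> F" for a using s(2) that by (simp add: least_Upper_iff[OF c(1)])
    have "least L (x \<squnion> s) (Upper L (insert x F))"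
      unfolding least_Upper_iff[OF c(4)]
    proof (intro conjI ballI impI)
      show "a \<sqsubseteq> x \<squnion> s" if "a \<in> insert x F" for a
        using that l[of a] c join_left[of x s] join_right[of x s] le_trans[of a s "x \<squnion> s"] by auto
      show "x \<squnion> s \<sqsubseteq> u" if "u \<in> carrier L" "\<forall>a\<in>insert x F. a \<sqsubseteq> u" for u
        using that s(2) c by (intro join_le) (auto simp: least_Upper_iff[OF c(1)])
    qed (use c in simp)
    then show ?case using V(3) s insert.prems by blast
  qed
  then show "\<exists>s\<in>C. least L s (Upper L F)" if "finite F" "F \<noteq> {}" "F \<subseteq> V" for F using that C by blast
qed

lemma ex_sup:
  assumes "A \<subseteq> carrier L" "A \<noteq> {}" shows "\<exists>s. least L s (Upper L A)"
proof -
  have "closedin T (carrier L)" by (metis closedin_topspace topspace_T)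
  moreover have "\<exists>s\<in>carrier L. least L s (Upper L F)" if "finite F" "F \<noteq> {}" "F \<subseteq> A" for F
  proof -
    have "least L (\<Squnion>F) (Upper L F)" using that assms by (intro finite_sup_least) auto
    then show ?thesis using that assms by (metis least_Upper_iff subset_trans)
  qed
  ultimately show ?thesis
    using least_in_closed[OF assms, of "carrier L"] by blast
qed

lemma Sup_le_iff:
  assumes "A \<subseteq> carrier L" "A \<noteq> {}"
  shows "\<Squnion>A \<in> carrier L" "u \<in> carrier L \<Longrightarrow> \<Squnion>A \<sqsubseteq> u \<longleftrightarrow> (\<forall>a\<in>A. a \<sqsubseteq> u)"
proof -
  have "least L (\<Squnion>A) (Upper L A)"
    unfolding sup_def using ex_sup[OF assms(1,2)] by (rule someI_ex)
  then have l: "\<Squnion>A \<in> carrier L" "\<And>a. a \<in> A \<Longrightarrow> a \<sqsubseteq> \<Squnion>A"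
    "\<And>u. \<lbrakk>u \<in> carrier L; \<forall>a\<in>A. a \<sqsubseteq> u\<rbrakk> \<Longrightarrow> \<Squnion>A \<sqsubseteq> u"
    by (simp_all add: least_Upper_iff[OF assms(1)])
  show "\<Squnion>A \<in> carrier L" by (rule l(1))
  show "\<Squnion>A \<sqsubseteq> u \<longleftrightarrow> (\<forall>a\<in>A. a \<sqsubseteq> u)" if "u \<in> carrier L"
    using l that assms(1) le_trans[of _ "\<Squnion>A" u] by blast
qed

lemma ex_bottom: "\<exists>b. least L b (carrier L)"
proof -
  let ?dn = "\<lambda>a. {x \<in> carrier L. x \<sqsubseteq> a}"
  have "\<Inter>(?dn ` carrier L) \<noteq> {}"
  proof (rule compact_space_fip[THEN iffD1, OF compact, rule_format], intro conjI ballI allI impI)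
    fix \<G> assume "finite \<G> \<and> \<G> \<subseteq> ?dn ` carrier L"
    then obtain F where F: "finite F" "F \<subseteq> carrier L" "\<G> = ?dn ` F"
      using finite_subset_image[of \<G> ?dn "carrier L"] by blast
    show "\<Inter>\<G> \<noteq> {}"
    proof (cases "F = {}")
      case False
      then have "greatest L (\<Sqinter>F) (Lower L F)" using F by (intro finite_inf_greatest) auto
      then have "\<Sqinter>F \<in> \<Inter>\<G>" using F by (auto simp: greatest_def Lower_def)
      then show ?thesis by blast
    qed (simp add: F)
  qed (auto intro: closedin_le)
  then show ?thesis using nonempty by (auto simp: least_def)
qed

lemma bottom: "\<bottom> \<in> carrier L" "x \<in> carrier L \<Longrightarrow> \<bottom> \<sqsubseteq> x"
proof -
  have "least L \<bottom> (carrier L)" unfolding bottom_def using ex_bottom by (rule someI_ex)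
  then show "\<bottom> \<in> carrier L" "x \<in> carrier L \<Longrightarrow> \<bottom> \<sqsubseteq> x" by (auto simp: least_def)
qed

section \<open>Interpolation and finite families of bounds\<close>

text \<open>Topological form of the way-below relation of the opposite order:
  \<open>s \<in> interior_below c\<close> says that \<open>c\<close> is way below \<open>s\<close>
  in the order dual of L.\<close>

definition interior_below :: "'l \<Rightarrow> 'l set" where
  "interior_below c = T interior_of {x \<in> carrier L. x \<sqsubseteq> c}"

lemma openin_interior_below: "openin T (interior_below c)"
  by (simp add: interior_below_def)

lemma interior_below_le: "x \<in> interior_below c \<Longrightarrow> x \<in> carrier L \<and> x \<sqsubseteq> c"
  using interior_of_subset[of T "{x \<in> carrier L. x \<sqsubseteq> c}"] unfolding interior_below_def by blast

text \<open>The preimage of the interior under \<open>x \<mapsto> x \<squnion> s\<close> is open,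
  contains \<open>t\<close> because \<open>t \<squnion> s = s\<close>, and consists of elements
  below \<open>c\<close> because \<open>x \<sqsubseteq> x \<squnion> s\<close>.\<close>

lemma interior_below_lower:
  assumes "s \<in> interior_below c" "t \<sqsubseteq> s" "t \<in> carrier L" "c \<in> carrier L"
  shows "t \<in> interior_below c"
proof -
  have s: "s \<in> carrier L" using assms interior_below_le by blast
  let ?U = "{x \<in> topspace T. x \<squnion> s \<in> interior_below c}"
  have "openin T ?U"
    using openin_continuous_map_preimage[OF continuous_join_right[OF s] openin_interior_below] .
  moreover have "?U \<subseteq> {x \<in> carrier L. x \<sqsubseteq> c}"
  proof
    fix x assume x: "x \<in> ?U"
    then have "x \<squnion> s \<sqsubseteq> c" "x \<in> carrier L" using interior_below_le by auto
    then show "x \<in> {x \<in> carrier L. x \<sqsubseteq> c}"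
      using s assms(4) le_trans[of x "x \<squnion> s" c] join_left[of x s] by auto
  qed
  moreover have "t \<in> ?U" using assms s by (simp add: le_iff_join_eq)
  ultimately show ?thesis unfolding interior_below_def by (meson interior_of_maximal subsetD)
qed

text \<open>The bound \<open>c\<close> is the join of a small neighbourhood of \<open>s\<close> that is a subsemilattice: by
  compactness this join lies in the closure of the neighbourhood.\<close>

lemma interpolate:
  assumes "\<gamma> \<in> carrier L" "s \<in> carrier L" "\<not> \<gamma> \<sqsubseteq> s"
  obtains c where "c \<in> carrier L" "s \<in> interior_below c" "\<not> \<gamma> \<sqsubseteq> c"
proof -
  let ?N = "topspace T - {x \<in> carrier L. \<gamma> \<sqsubseteq> x}"
  have "openin T ?N" using closedin_ge[OF assms(1)] by (simp only: openin_diff openin_topspace)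
  moreover have "s \<in> ?N" using assms by auto
  moreover have "neighbourhood_base_of (closedin T) T"
    using compact Hausdorff_T by (simp add: compact_Hausdorff_imp_regular_space neighbourhood_base_of_closedin)
  \<comment> \<open>The join of \<open>V\<close> is only known to lie in closed sets around
    \<open>V\<close>, so a closed \<open>D\<close> is placed between \<open>N\<close> and the open
    set \<open>?N\<close> of elements not above \<open>\<gamma>\<close>.\<close>
  ultimately obtain N D where N: "openin T N" "closedin T D" "s \<in> N" "N \<subseteq> D" "D \<subseteq> ?N"
    unfolding neighbourhood_base_of by meson
  then obtain U V where UV: "openin T U" "upper_subsemilattice L V" "s \<in> U" "U \<subseteq> V" "V \<subseteq> N"
    using upper assms(2) unfolding Lawson_upper_semilattice_def neighbourhood_base_at_def by meson
  have "V \<subseteq> D" "V \<noteq> {}" using UV(3-5) N(4) by auto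
  then obtain c where c: "c \<in> D" "least L c (Upper L V)"
    using sup_in_closed[of V D] N(2) UV(2) unfolding upper_subsemilattice_def by blast
  have V: "V \<subseteq> carrier L" using UV(2) by (simp add: upper_subsemilattice_def)
  then have "U \<subseteq> {x \<in> carrier L. x \<sqsubseteq> c}"
    using c(2) UV(4) unfolding least_Upper_iff[OF V] by blast
  then have "s \<in> interior_below c" unfolding interior_below_def using UV(1,3) by (meson interior_of_maximal subsetD)
  moreover have "c \<in> carrier L" "\<not> \<gamma> \<sqsubseteq> c" using c N(5) by (auto simp: least_def)
  ultimately show thesis using that by blast
qed

text \<open>If \<open>w \<sqsubseteq> x\<close> then \<open>x \<sqinter> w = w\<close>, and
  conversely any \<open>x \<sqinter> w\<close> in \<open>W\<close> is an element of \<open>W\<close>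
  below \<open>x\<close>; so the up-set is a union of preimages under the maps
  \<open>x \<mapsto> x \<sqinter> w\<close>.\<close>

lemma openin_upward:
  assumes "openin T W" shows "openin T {x \<in> carrier L. \<exists>w\<in>W. w \<sqsubseteq> x}"
proof -
  have W: "W \<subseteq> carrier L" using openin_subset[OF assms] by simp
  have "{x \<in> carrier L. \<exists>w\<in>W. w \<sqsubseteq> x} = \<Union>((\<lambda>w. {x \<in> topspace T. x \<sqinter> w \<in> W}) ` W)"
  proof (intro subset_antisym subsetI)
    fix x assume "x \<in> {x \<in> carrier L. \<exists>w\<in>W. w \<sqsubseteq> x}"
    then obtain w where "x \<in> carrier L" "w \<in> W" "w \<sqsubseteq> x" by blast
    moreover from this have "x \<sqinter> w = w" using W le_iff_meet_eq by blast
    ultimately show "x \<in> \<Union>((\<lambda>w. {x \<in> topspace T. x \<sqinter> w \<in> W}) ` W)"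
      by (intro UN_I[of w]) auto
  next
    fix x assume "x \<in> \<Union>((\<lambda>w. {x \<in> topspace T. x \<sqinter> w \<in> W}) ` W)"
    then obtain w where "x \<in> carrier L" "w \<in> W" "x \<sqinter> w \<in> W" by auto
    then show "x \<in> {x \<in> carrier L. \<exists>w\<in>W. w \<sqsubseteq> x}" using W meet_left by blast
  qed
  moreover have "openin T {x \<in> topspace T. x \<sqinter> w \<in> W}" if "w \<in> W" for w
    using openin_continuous_map_preimage[OF continuous_meet_right assms] that W by blast
  ultimately show ?thesis by auto
qed

text \<open>Outside the open up-set of \<open>W\<close> nothing lies above \<open>\<gamma>\<close>,
  so \<open>interpolate\<close> covers this compact set by sets \<open>interior_below c\<close>; the
  \<open>c\<close> of a finite subcover are the bounds. Since R^cup is closed downwards in its last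
  coordinate, reaching the up-set of \<open>W\<close> is as good as reaching
  \<open>W\<close>.\<close>

lemma finite_bounds:
  assumes "openin T W" "\<gamma> \<in> W"
  obtains C where "finite C" "C \<subseteq> carrier L" "\<And>c. c \<in> C \<Longrightarrow> \<not> \<gamma> \<sqsubseteq> c"
    "\<And>x. \<lbrakk>x \<in> carrier L; \<And>c. c \<in> C \<Longrightarrow> \<not> x \<sqsubseteq> c\<rbrakk> \<Longrightarrow> \<exists>w\<in>W. w \<sqsubseteq> x"
proof -
  let ?U = "{x \<in> carrier L. \<exists>w\<in>W. w \<sqsubseteq> x}"
  have g: "\<gamma> \<in> carrier L" using openin_subset[OF assms(1)] assms(2) by auto
  have "compactin T (topspace T - ?U)"
    using compact openin_upward[OF assms(1)] by (intro closedin_compact_space closedin_diff closedin_topspace)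
  moreover have "topspace T - ?U \<subseteq> \<Union>(interior_below ` {c \<in> carrier L. \<not> \<gamma> \<sqsubseteq> c})"
  proof
    fix s assume "s \<in> topspace T - ?U"
    then have "s \<in> carrier L" "\<not> \<gamma> \<sqsubseteq> s" using assms(2) by auto
    then obtain c where "c \<in> carrier L" "s \<in> interior_below c" "\<not> \<gamma> \<sqsubseteq> c"
      using interpolate[OF g] by metis
    then show "s \<in> \<Union>(interior_below ` {c \<in> carrier L. \<not> \<gamma> \<sqsubseteq> c})" by (intro UN_I[of c]) simp_all
  qed
  moreover have "openin T S" if "S \<in> interior_below ` {c \<in> carrier L. \<not> \<gamma> \<sqsubseteq> c}" for S
    using that openin_interior_below by auto
  ultimately obtain \<F> where F: "finite \<F>" "\<F> \<subseteq> interior_below ` {c \<in> carrier L. \<not> \<gamma> \<sqsubseteq> c}" "topspace T - ?U \<subseteq> \<Union>\<F>"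
    using compactinD[of T "topspace T - ?U" "interior_below ` {c \<in> carrier L. \<not> \<gamma> \<sqsubseteq> c}"] by meson
  from finite_subset_image[OF F(1,2)] obtain C where C: "C \<subseteq> {c \<in> carrier L. \<not> \<gamma> \<sqsubseteq> c}" "finite C" "\<F> = interior_below ` C"
    by (elim exE conjE)
  show thesis
  proof (rule that[of C])
    show "\<exists>w\<in>W. w \<sqsubseteq> x" if "x \<in> carrier L" "\<And>c. c \<in> C \<Longrightarrow> \<not> x \<sqsubseteq> c" for x
    proof (rule ccontr)
      assume "\<not> (\<exists>w\<in>W. w \<sqsubseteq> x)"
      then have "x \<in> \<Union>\<F>" using F(3) that(1) by auto
      then show False using C(3) that(2) interior_below_le by blast
    qed
  qed (use C in auto)
qed

end

section \<open>Strict ambiguous representations\<close>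

locale strict_representations = compact_Lawson_lattice L T
  for L :: "'l gorder" (structure) and T :: "'l topology" +
  fixes X :: "'a topology" and Y :: "'b topology"
  assumes X: "compact_space X" "Hausdorff_space X" "topspace X \<noteq> {}"
    and Y: "compact_space Y" "Hausdorff_space Y" "topspace Y \<noteq> {}"
begin

abbreviation SR :: "('a set \<times> 'b set \<times> 'l) set \<Rightarrow> bool" where
  "SR \<equiv> strict_ambiguous_representation X Y T L"

abbreviation cup :: "('a set \<times> 'b set \<times> 'l) set \<Rightarrow> ('a set set \<times> 'b set \<times> 'l) set" where
  "cup \<equiv> rep_cup X Y L"

abbreviation P :: "('a set \<times> 'b set \<times> 'l) topology" where
  "P \<equiv> prod_topology (vietoris X) (prod_topology (vietoris Y) T)"

abbreviation Z :: "('a set set \<times> 'b set \<times> 'l) topology" where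
  "Z \<equiv> prod_topology (vietoris (vietoris X)) (prod_topology (vietoris Y) T)"

lemmas compact_exp = compact_space_vietoris[OF X(1)] compact_space_vietoris[OF Y(1)]
lemmas Hausdorff_exp = Hausdorff_space_vietoris[OF X(1,2)] Hausdorff_space_vietoris[OF Y(1,2)]

lemma compact_P: "compact_space P"
  by (simp add: compact_space_prod_topology compact_exp compact)

lemma compact_Z: "compact_space Z"
  by (simp add: compact_space_prod_topology compact_exp compact compact_space_vietoris)

lemma Hausdorff_Z: "Hausdorff_space Z"
  by (simp add: Hausdorff_space_prod_topology Hausdorff_space_vietoris compact_exp Hausdorff_exp Hausdorff_T)

lemma topspace_P: "topspace P = exp_set X \<times> exp_set Y \<times> carrier L"
  by (simp add: topspace_vietoris)

lemma topspace_Z: "topspace Z = exp_set (vietoris X) \<times> exp_set Y \<times> carrier L"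
  by (simp add: topspace_vietoris)

lemma topspace_Y_exp: "topspace Y \<in> exp_set Y"
  using Y(3) by (rule topspace_in_exp_set)

lemma exp2_subset: "\<lbrakk>\<A> \<in> exp_set (vietoris X); A \<in> \<A>\<rbrakk> \<Longrightarrow> A \<in> exp_set X"
  using closedin_subset[of "vietoris X" \<A>] by (auto simp: exp_set_iff topspace_vietoris)

section \<open>Axioms, sections and intersections of representations\<close>

lemma SR_D:
  assumes "SR R"
  shows "R \<subseteq> exp_set X \<times> exp_set Y \<times> carrier L"
    and "\<lbrakk>(A, B, \<alpha>) \<in> R; A' \<subseteq> A; B \<subseteq> B'; \<alpha>' \<sqsubseteq> \<alpha>; A' \<in> exp_set X; B' \<in> exp_set Y; \<alpha>' \<in> carrier L\<rbrakk>
      \<Longrightarrow> (A', B', \<alpha>') \<in> R"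
    and "\<lbrakk>(A, B, \<alpha>) \<in> R; (A, B, \<beta>) \<in> R\<rbrakk> \<Longrightarrow> (A, B, \<alpha> \<squnion> \<beta>) \<in> R"
    and "\<lbrakk>A \<in> exp_set X; \<alpha> \<in> carrier L\<rbrakk> \<Longrightarrow> (A, topspace Y, \<alpha>) \<in> R"
    and "\<lbrakk>A \<in> exp_set X; B \<in> exp_set Y\<rbrakk> \<Longrightarrow> (A, B, \<bottom>) \<in> R"
    and "A \<in> exp_set X \<Longrightarrow> closedin (prod_topology (vietoris Y) T) {(B, \<alpha>). (A, B, \<alpha>) \<in> R}"
    and "B \<in> exp_set Y \<Longrightarrow> closedin (prod_topology (vietoris X) T) {(A, \<alpha>). (A, B, \<alpha>) \<in> R}"
proof -
  note a = assms[unfolded strict_ambiguous_representation_def ambiguous_representation_def]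
  from a have sub: "R \<subseteq> exp_set X \<times> exp_set Y \<times> carrier L"
    and mono: "\<forall>A\<in>exp_set X. \<forall>A'\<in>exp_set X. \<forall>B\<in>exp_set Y. \<forall>B'\<in>exp_set Y. \<forall>\<alpha>\<in>carrier L. \<forall>\<alpha>'\<in>carrier L.
      A' \<subseteq> A \<and> B \<subseteq> B' \<and> \<alpha>' \<sqsubseteq> \<alpha> \<and> (A, B, \<alpha>) \<in> R \<longrightarrow> (A', B', \<alpha>') \<in> R"
    and join: "\<forall>A B \<alpha> \<beta>. (A, B, \<alpha>) \<in> R \<and> (A, B, \<beta>) \<in> R \<longrightarrow> (A, B, \<alpha> \<squnion> \<beta>) \<in> R"
    and bounds: "\<forall>A\<in>exp_set X. \<forall>B\<in>exp_set Y. \<forall>\<alpha>\<in>carrier L. (A, topspace Y, \<alpha>) \<in> R \<and> (A, B, \<bottom>) \<in> R"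
    and cl: "\<forall>A\<in>exp_set X. closedin (prod_topology (vietoris Y) T) {(B, \<alpha>). (A, B, \<alpha>) \<in> R}"
      "\<forall>B\<in>exp_set Y. closedin (prod_topology (vietoris X) T) {(A, \<alpha>). (A, B, \<alpha>) \<in> R}"
    by - (elim conjE, assumption)+
  show "R \<subseteq> exp_set X \<times> exp_set Y \<times> carrier L" by (rule sub)
  show "(A', B', \<alpha>') \<in> R" if *: "(A, B, \<alpha>) \<in> R" "A' \<subseteq> A" "B \<subseteq> B'" "\<alpha>' \<sqsubseteq> \<alpha>"
    "A' \<in> exp_set X" "B' \<in> exp_set Y" "\<alpha>' \<in> carrier L"
  proof -
    have "A \<in> exp_set X" "B \<in> exp_set Y" "\<alpha> \<in> carrier L" using *(1) sub by auto
    from mono[rule_format, OF this(1) *(5) this(2) *(6) this(3) *(7)] * show ?thesis by simp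
  qed
  show "(A, B, \<alpha> \<squnion> \<beta>) \<in> R" if "(A, B, \<alpha>) \<in> R" "(A, B, \<beta>) \<in> R"
    using join that by simp
  show "(A, topspace Y, \<alpha>) \<in> R" if "A \<in> exp_set X" "\<alpha> \<in> carrier L"
    using bounds that topspace_Y_exp by simp
  show "(A, B, \<bottom>) \<in> R" if "A \<in> exp_set X" "B \<in> exp_set Y"
    using bounds that bottom(1) by simp
  show "A \<in> exp_set X \<Longrightarrow> closedin (prod_topology (vietoris Y) T) {(B, \<alpha>). (A, B, \<alpha>) \<in> R}"
    using cl(1) by simp
  show "B \<in> exp_set Y \<Longrightarrow> closedin (prod_topology (vietoris X) T) {(A, \<alpha>). (A, B, \<alpha>) \<in> R}"
    using cl(2) by simp
qed

lemma SR_I: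
  assumes "R \<subseteq> exp_set X \<times> exp_set Y \<times> carrier L"
    and "\<And>A B \<alpha> A' B' \<alpha>'. \<lbrakk>(A, B, \<alpha>) \<in> R; A' \<subseteq> A; B \<subseteq> B'; \<alpha>' \<sqsubseteq> \<alpha>; A' \<in> exp_set X; B' \<in> exp_set Y; \<alpha>' \<in> carrier L\<rbrakk>
      \<Longrightarrow> (A', B', \<alpha>') \<in> R"
    and "\<And>A B \<alpha> \<beta>. \<lbrakk>(A, B, \<alpha>) \<in> R; (A, B, \<beta>) \<in> R\<rbrakk> \<Longrightarrow> (A, B, \<alpha> \<squnion> \<beta>) \<in> R"
    and "\<And>A \<alpha>. \<lbrakk>A \<in> exp_set X; \<alpha> \<in> carrier L\<rbrakk> \<Longrightarrow> (A, topspace Y, \<alpha>) \<in> R"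
    and "\<And>A B. \<lbrakk>A \<in> exp_set X; B \<in> exp_set Y\<rbrakk> \<Longrightarrow> (A, B, \<bottom>) \<in> R"
    and "\<And>A. A \<in> exp_set X \<Longrightarrow> closedin (prod_topology (vietoris Y) T) {(B, \<alpha>). (A, B, \<alpha>) \<in> R}"
    and "\<And>B. B \<in> exp_set Y \<Longrightarrow> closedin (prod_topology (vietoris X) T) {(A, \<alpha>). (A, B, \<alpha>) \<in> R}"
  shows "SR R"
  unfolding strict_ambiguous_representation_def ambiguous_representation_def
proof (intro conjI ballI allI impI; (elim conjE)?)
  show "(A', B', \<alpha>') \<in> R"
    if "(A, B, \<alpha>) \<in> R" "A' \<subseteq> A" "B \<subseteq> B'" "\<alpha>' \<sqsubseteq> \<alpha>" "A' \<in> exp_set X" "B' \<in> exp_set Y" "\<alpha>' \<in> carrier L"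
    for A B \<alpha> A' B' \<alpha>' by (rule assms(2)[OF that])
  show "(A, B, \<alpha> \<squnion> \<beta>) \<in> R" if "(A, B, \<alpha>) \<in> R" "(A, B, \<beta>) \<in> R" for A B \<alpha> \<beta>
    by (rule assms(3)[OF that])
qed (rule assms; assumption)+

lemma closed_sections:
  assumes R: "closedin P R"
  shows "A \<in> exp_set X \<Longrightarrow> closedin (prod_topology (vietoris Y) T) {(B, \<alpha>). (A, B, \<alpha>) \<in> R}"
    and "B \<in> exp_set Y \<Longrightarrow> closedin (prod_topology (vietoris X) T) {(A, \<alpha>). (A, B, \<alpha>) \<in> R}"
proof -
  have sub: "R \<subseteq> exp_set X \<times> exp_set Y \<times> carrier L" using closedin_subset[OF R] unfolding topspace_P .
  show "closedin (prod_topology (vietoris Y) T) {(B, \<alpha>). (A, B, \<alpha>) \<in> R}" if A: "A \<in> exp_set X"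
  proof -
    have "continuous_map (prod_topology (vietoris Y) T) P (\<lambda>p. (A, p))"
      using A by (simp add: continuous_map_pairwise o_def topspace_vietoris)
    from closedin_continuous_map_preimage[OF this R]
    have "closedin (prod_topology (vietoris Y) T) {p \<in> topspace (prod_topology (vietoris Y) T). (A, p) \<in> R}" .
    moreover have "{p \<in> topspace (prod_topology (vietoris Y) T). (A, p) \<in> R} = {(B, \<alpha>). (A, B, \<alpha>) \<in> R}"
      using sub by (auto simp: topspace_vietoris)
    ultimately show ?thesis by simp
  qed
  show "closedin (prod_topology (vietoris X) T) {(A, \<alpha>). (A, B, \<alpha>) \<in> R}" if B: "B \<in> exp_set Y"
  proof -
    have "continuous_map (prod_topology (vietoris X) T) P (\<lambda>p. (fst p, B, snd p))"
      using B by (simp add: continuous_map_pairwise o_def topspace_vietoris continuous_map_fst continuous_map_snd)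
    from closedin_continuous_map_preimage[OF this R]
    have "closedin (prod_topology (vietoris X) T)
      {p \<in> topspace (prod_topology (vietoris X) T). (fst p, B, snd p) \<in> R}" .
    moreover have "{p \<in> topspace (prod_topology (vietoris X) T). (fst p, B, snd p) \<in> R} = {(A, \<alpha>). (A, B, \<alpha>) \<in> R}"
      using sub by (auto simp: topspace_vietoris)
    ultimately show ?thesis by simp
  qed
qed

lemma SR_top: "SR (exp_set X \<times> exp_set Y \<times> carrier L)"
proof (rule SR_I)
  have P: "closedin P (exp_set X \<times> exp_set Y \<times> carrier L)"
    by (metis closedin_topspace topspace_P)
  note s = closed_sections[OF P]
  show "closedin (prod_topology (vietoris Y) T) {(B, \<alpha>). (A, B, \<alpha>) \<in> exp_set X \<times> exp_set Y \<times> carrier L}"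
    if "A \<in> exp_set X" for A using s(1) that .
  show "closedin (prod_topology (vietoris X) T) {(A, \<alpha>). (A, B, \<alpha>) \<in> exp_set X \<times> exp_set Y \<times> carrier L}"
    if "B \<in> exp_set Y" for B using s(2) that .
qed (auto simp: bottom topspace_Y_exp)

lemma SR_Inter:
  assumes "\<R> \<noteq> {}" and R: "\<And>R. R \<in> \<R> \<Longrightarrow> SR R"
  shows "SR (\<Inter>\<R>)"
proof (rule SR_I)
  obtain R0 where "R0 \<in> \<R>" using assms(1) by blast
  then show "\<Inter>\<R> \<subseteq> exp_set X \<times> exp_set Y \<times> carrier L" using SR_D(1)[OF R] by blast
  show "closedin (prod_topology (vietoris Y) T) {(B, \<alpha>). (A, B, \<alpha>) \<in> \<Inter>\<R>}" if "A \<in> exp_set X" for A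
  proof -
    have "{(B, \<alpha>). (A, B, \<alpha>) \<in> \<Inter>\<R>} = (\<Inter>R\<in>\<R>. {(B, \<alpha>). (A, B, \<alpha>) \<in> R})" by auto
    then show ?thesis using assms(1) SR_D(6)[OF R that] by auto
  qed
  show "closedin (prod_topology (vietoris X) T) {(A, \<alpha>). (A, B, \<alpha>) \<in> \<Inter>\<R>}" if "B \<in> exp_set Y" for B
  proof -
    have "{(A, \<alpha>). (A, B, \<alpha>) \<in> \<Inter>\<R>} = (\<Inter>R\<in>\<R>. {(A, \<alpha>). (A, B, \<alpha>) \<in> R})" by auto
    then show ?thesis using assms(1) SR_D(7)[OF R that] by auto
  qed
next
  fix A B \<alpha> A' B' \<alpha>'
  assume *: "(A, B, \<alpha>) \<in> \<Inter>\<R>" "A' \<subseteq> A" "B \<subseteq> B'" "\<alpha>' \<sqsubseteq> \<alpha>" "A' \<in> exp_set X" "B' \<in> exp_set Y" "\<alpha>' \<in> carrier L"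
  show "(A', B', \<alpha>') \<in> \<Inter>\<R>"
  proof
    fix R assume r: "R \<in> \<R>"
    then have "(A, B, \<alpha>) \<in> R" using *(1) by blast
    from SR_D(2)[OF R[OF r] this *(2-)] show "(A', B', \<alpha>') \<in> R" .
  qed
qed (use SR_D(3,4,5)[OF R] in auto)

section \<open>The map from R to R^cup\<close>

text \<open>To lie below a supremum is to lie below all upper bounds. In this form a missing point
  comes with one witness \<open>u\<close>, from which \<open>point_separation\<close> starts, and
  one bound \<open>c\<close> suffices to exclude membership.\<close>

lemma rep_cup_iff:
  assumes "SR R"
  shows "(\<A>, B, \<gamma>) \<in> cup R \<longleftrightarrow>
    \<A> \<in> exp_set (vietoris X) \<and> B \<in> exp_set Y \<and> \<gamma> \<in> carrier L \<and>
    (\<forall>u\<in>carrier L. (\<forall>A\<in>\<A>. \<forall>\<alpha>. (A, B, \<alpha>) \<in> R \<longrightarrow> \<alpha> \<sqsubseteq> u) \<longrightarrow> \<gamma> \<sqsubseteq> u)"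
proof -
  let ?S = "{\<alpha> \<in> carrier L. \<exists>A\<in>\<A>. (A, B, \<alpha>) \<in> R}"
  have "\<gamma> \<sqsubseteq> \<Squnion>?S \<longleftrightarrow> (\<forall>u\<in>carrier L. (\<forall>A\<in>\<A>. \<forall>\<alpha>. (A, B, \<alpha>) \<in> R \<longrightarrow> \<alpha> \<sqsubseteq> u) \<longrightarrow> \<gamma> \<sqsubseteq> u)"
    if *: "\<A> \<in> exp_set (vietoris X)" "B \<in> exp_set Y" "\<gamma> \<in> carrier L"
  proof -
    obtain A where A: "A \<in> \<A>" using * by (auto simp: exp_set_iff)
    \<comment> \<open>The bottom value keeps \<open>?S\<close> non-empty, as required for
      \<open>Sup_le_iff\<close>.\<close>
    then have "(A, B, \<bottom>) \<in> R" using SR_D(5)[OF assms exp2_subset[OF *(1)] *(2)] by blast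
    then have ne: "?S \<noteq> {}" using A bottom(1) by blast
    have sc: "\<Squnion>?S \<in> carrier L" by (rule Sup_le_iff(1)[OF _ ne]) blast
    have le: "\<Squnion>?S \<sqsubseteq> u \<longleftrightarrow> (\<forall>A\<in>\<A>. \<forall>\<alpha>. (A, B, \<alpha>) \<in> R \<longrightarrow> \<alpha> \<sqsubseteq> u)" if "u \<in> carrier L" for u
      using Sup_le_iff(2)[OF _ ne that] SR_D(1)[OF assms] by auto
    show ?thesis
    proof
      assume "\<gamma> \<sqsubseteq> \<Squnion>?S"
      then show "\<forall>u\<in>carrier L. (\<forall>A\<in>\<A>. \<forall>\<alpha>. (A, B, \<alpha>) \<in> R \<longrightarrow> \<alpha> \<sqsubseteq> u) \<longrightarrow> \<gamma> \<sqsubseteq> u"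
        using le_trans[OF _ _ *(3) sc] le by meson
    next
      assume "\<forall>u\<in>carrier L. (\<forall>A\<in>\<A>. \<forall>\<alpha>. (A, B, \<alpha>) \<in> R \<longrightarrow> \<alpha> \<sqsubseteq> u) \<longrightarrow> \<gamma> \<sqsubseteq> u"
      then show "\<gamma> \<sqsubseteq> \<Squnion>?S" using le[OF sc] sc by simp
    qed
  qed
  then show ?thesis unfolding rep_cup_def by auto
qed

lemma rep_cup_mono: "\<lbrakk>SR R; SR S; R \<subseteq> S\<rbrakk> \<Longrightarrow> cup R \<subseteq> cup S"
  by (clarsimp simp: rep_cup_iff) blast

text \<open>All values are prescribed over \<open>topspace Y\<close>, so no representation can be
  told from another there. A point missed by some \<open>cup R\<close> therefore has a proper second
  coordinate.\<close>

lemma rep_cup_top: "\<lbrakk>SR R; \<A> \<in> exp_set (vietoris X); \<gamma> \<in> carrier L\<rbrakk> \<Longrightarrow> (\<A>, topspace Y, \<gamma>) \<in> cup R"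
proof -
  assume *: "SR R" "\<A> \<in> exp_set (vietoris X)" "\<gamma> \<in> carrier L"
  then obtain A where A: "A \<in> \<A>" by (auto simp: exp_set_iff)
  then have "(A, topspace Y, \<gamma>) \<in> R" using * exp2_subset SR_D(4) by blast
  then show ?thesis using * A topspace_Y_exp by (auto simp: rep_cup_iff)
qed

lemma sing_exp2: "A \<in> exp_set X \<Longrightarrow> {A} \<in> exp_set (vietoris X)"
  using Hausdorff_exp(1) by (simp add: sing_in_exp_set topspace_vietoris)

text \<open>The values of R at \<open>(A, B)\<close> form a closed set stable under joins, so their
  supremum is one of them. Hence R can be read off from \<open>cup R\<close> along singletons, which
  yields injectivity and transfers miss conditions between \<open>P\<close> and
  \<open>Z\<close>.\<close>

lemma rep_cup_sing:
  assumes R: "SR R" and A: "A \<in> exp_set X"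
  shows "({A}, B, \<gamma>) \<in> cup R \<longleftrightarrow> (A, B, \<gamma>) \<in> R"
proof
  assume "(A, B, \<gamma>) \<in> R"
  then show "({A}, B, \<gamma>) \<in> cup R"
    using SR_D(1)[OF R] sing_exp2[OF A] by (auto simp: rep_cup_iff[OF R])
next
  assume g: "({A}, B, \<gamma>) \<in> cup R"
  then have B: "B \<in> exp_set Y" "\<gamma> \<in> carrier L" by (simp_all add: rep_cup_iff[OF R])
  let ?V = "{\<alpha>. (A, B, \<alpha>) \<in> R}"
  have V: "?V \<subseteq> carrier L" "?V \<noteq> {}" using SR_D(1)[OF R] SR_D(5)[OF R A B(1)] by auto
  have "continuous_map T (prod_topology (vietoris Y) T) (\<lambda>\<alpha>. (B, \<alpha>))"
    using B by (simp add: continuous_map_pairwise o_def topspace_vietoris)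
  from closedin_continuous_map_preimage[OF this SR_D(6)[OF R A]]
  have "closedin T {\<alpha> \<in> topspace T. (B, \<alpha>) \<in> {(B, \<alpha>). (A, B, \<alpha>) \<in> R}}" .
  moreover have "{\<alpha> \<in> topspace T. (B, \<alpha>) \<in> {(B, \<alpha>). (A, B, \<alpha>) \<in> R}} = ?V" using V(1) by auto
  ultimately have "closedin T ?V" by simp
  then obtain p where p: "p \<in> ?V" "least L p (Upper L ?V)"
    using sup_in_closed[OF V _ _ subset_refl] SR_D(3)[OF R] by blast
  have "\<gamma> \<sqsubseteq> p" using g p(2) unfolding rep_cup_iff[OF R] least_Upper_iff[OF V(1)] by auto
  then show "(A, B, \<gamma>) \<in> R" using SR_D(2)[OF R _ subset_refl subset_refl _ A B] p(1) by blast
qed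

section \<open>Capped representations\<close>

text \<open>The cap extends from \<open>\<U>\<close> to all supersets of its members because a value
  at \<open>A\<close> is inherited by every smaller \<open>A'\<close>; without this the set would
  violate monotonicity in the first coordinate.\<close>

definition capped :: "'a set set \<Rightarrow> 'b set \<Rightarrow> 'l \<Rightarrow> ('a set \<times> 'b set \<times> 'l) set" where
  "capped \<U> V c = {(A, B, \<alpha>) \<in> exp_set X \<times> exp_set Y \<times> carrier L. (\<exists>A'\<in>\<U>. A' \<subseteq> A) \<and> B \<subseteq> V \<longrightarrow> \<alpha> \<sqsubseteq> c}"

lemma closedin_capped:
  assumes "openin (vietoris X) \<U>" "openin Y V" "c \<in> carrier L"
  shows "closedin P (capped \<U> V c)"
proof -
  have "topspace P - capped \<U> V c =
      {A \<in> exp_set X. \<exists>A'\<in>\<U>. A' \<subseteq> A} \<times> {B \<in> exp_set Y. B \<subseteq> V} \<times> {\<alpha> \<in> carrier L. \<not> \<alpha> \<sqsubseteq> c}"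
    unfolding topspace_P capped_def by auto
  moreover have "openin P \<dots>"
    using assms X by (intro openin_prod_Times_iff[THEN iffD2] disjI2 conjI openin_vietoris_supsets
        openin_vietoris_subset openin_not_le)
  moreover have "capped \<U> V c \<subseteq> topspace P" unfolding topspace_P capped_def by auto
  ultimately show ?thesis unfolding closedin_def by simp
qed

lemma SR_capped:
  assumes "openin (vietoris X) \<U>" "openin Y V" "V \<noteq> topspace Y" "c \<in> carrier L"
  shows "SR (capped \<U> V c)"
proof (rule SR_I)
  note s = closed_sections[OF closedin_capped[OF assms(1,2,4)]]
  show "closedin (prod_topology (vietoris Y) T) {(B, \<alpha>). (A, B, \<alpha>) \<in> capped \<U> V c}"
    if "A \<in> exp_set X" for A using s(1) that .
  show "closedin (prod_topology (vietoris X) T) {(A, \<alpha>). (A, B, \<alpha>) \<in> capped \<U> V c}"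
    if "B \<in> exp_set Y" for B using s(2) that .
next
  fix A B \<alpha> A' B' \<alpha>'
  assume *: "(A, B, \<alpha>) \<in> capped \<U> V c" "A' \<subseteq> A" "B \<subseteq> B'" "\<alpha>' \<sqsubseteq> \<alpha>" "A' \<in> exp_set X" "B' \<in> exp_set Y" "\<alpha>' \<in> carrier L"
  have "\<alpha>' \<sqsubseteq> c" if "A'' \<in> \<U>" "A'' \<subseteq> A'" "B' \<subseteq> V" for A''
  proof -
    have "A'' \<subseteq> A" "B \<subseteq> V" using that *(2,3) by auto
    then have "\<alpha> \<sqsubseteq> c" "\<alpha> \<in> carrier L" using *(1) that(1) unfolding capped_def by auto
    then show ?thesis using le_trans[OF *(4)] *(7) assms(4) by blast
  qed
  then show "(A', B', \<alpha>') \<in> capped \<U> V c" using *(5-7) unfolding capped_def by auto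
next
  \<comment> \<open>Here \<open>V\<close> must be proper: a cap over the whole of \<open>Y\<close>
    would contradict the values prescribed there.\<close>
  have "\<not> topspace Y \<subseteq> V" using assms(2,3) openin_subset by blast
  then show "(A, topspace Y, \<alpha>) \<in> capped \<U> V c" if "A \<in> exp_set X" "\<alpha> \<in> carrier L" for A \<alpha>
    using that topspace_Y_exp unfolding capped_def by auto
qed (use assms(4) in \<open>auto simp: capped_def bottom intro: join_le\<close>)

text \<open>Monotonicity of R carries a value from a superset \<open>A\<close> down to the member of
  \<open>\<U>\<close> inside it, so testing the members of \<open>\<U>\<close> is enough. This is
  the maximality of the capped representation.\<close>

lemma subset_capped_iff:
  assumes R: "SR R" and \<U>: "\<U> \<subseteq> exp_set X"
  shows "R \<subseteq> capped \<U> V c \<longleftrightarrow> (\<forall>A B \<alpha>. A \<in> \<U> \<and> B \<subseteq> V \<and> (A, B, \<alpha>) \<in> R \<longrightarrow> \<alpha> \<sqsubseteq> c)" (is "?l = ?r")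
proof
  assume ?l
  then show ?r unfolding capped_def by blast
next
  assume r: ?r
  show ?l
  proof
    fix x assume x: "x \<in> R"
    obtain A B \<alpha> where xx: "x = (A, B, \<alpha>)" by (cases x) 
    have c: "A \<in> exp_set X" "B \<in> exp_set Y" "\<alpha> \<in> carrier L" using SR_D(1)[OF R] x xx by auto
    have "\<alpha> \<sqsubseteq> c" if "A' \<in> \<U>" "A' \<subseteq> A" "B \<subseteq> V" for A'
    proof -
      have "(A', B, \<alpha>) \<in> R"
        using SR_D(2)[OF R x[unfolded xx] that(2) subset_refl le_refl[OF c(3)] _ c(2,3)] \<U> that(1) by blast
      then show ?thesis using r that by blast
    qed
    then show "x \<in> capped \<U> V c" using c unfolding xx capped_def by auto
  qed
qed

text \<open>Separate closedness suffices here because of monotonicity: first the second coordinate is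
  enlarged to a closed neighbourhood, and only then is the first coordinate varied.\<close>

lemma tube:
  assumes R: "SR R" and A: "A \<in> exp_set X" and B: "B \<in> exp_set Y" "B \<noteq> topspace Y"
    and I: "openin T I" "\<And>\<alpha>. (A, B, \<alpha>) \<in> R \<Longrightarrow> \<alpha> \<in> I"
  obtains \<U> V K where "openin (vietoris X) \<U>" "A \<in> \<U>" "openin Y V" "B \<subseteq> V" "V \<noteq> topspace Y"
    "closedin P K" "R \<inter> K = {}"
    "\<And>A' B' \<alpha>. \<lbrakk>A' \<in> \<U>; B' \<in> exp_set Y; B' \<subseteq> V; \<alpha> \<in> carrier L; \<alpha> \<notin> I\<rbrakk> \<Longrightarrow> (A', B', \<alpha>) \<in> K"
proof -
  have cI: "closedin T (topspace T - I)" using I(1) by blast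
  \<comment> \<open>\<open>?E\<close> collects the pairs of R over \<open>A\<close> whose value is
    outside \<open>I\<close>. As \<open>T\<close> is compact, its projection is closed, so the bad
    second coordinates can be avoided near \<open>B\<close>.\<close>
  let ?E = "{(B, \<alpha>). (A, B, \<alpha>) \<in> R} \<inter> (topspace (vietoris Y) \<times> (topspace T - I))"
  have "closedin (prod_topology (vietoris Y) T) ?E"
    using SR_D(6)[OF R A] cI by (intro closedin_Int) (simp_all add: closedin_prod_Times_iff)
  then have "closedin (vietoris Y) (fst ` ?E)"
    using closed_map_fst[OF compact] unfolding closed_map_def by blast
  then have "openin (vietoris Y) (topspace (vietoris Y) - fst ` ?E)" by blast
  moreover have "B \<in> topspace (vietoris Y) - fst ` ?E"
    using B I(2) by (auto simp: topspace_vietoris)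
  ultimately obtain V D where V: "openin Y V" "closedin Y D" "B \<subseteq> V" "V \<subseteq> D"
      "D \<in> topspace (vietoris Y) - fst ` ?E"
    using vietoris_closed_nbhd[OF Y(1,2)] by blast
  have D: "D \<in> exp_set Y" using V(5) by (simp add: topspace_vietoris)
  have DI: "\<alpha> \<in> I" if "(A, D, \<alpha>) \<in> R" for \<alpha>
  proof (rule ccontr)
    assume "\<alpha> \<notin> I"
    then have "(D, \<alpha>) \<in> ?E" using that D SR_D(1)[OF R] by (auto simp: topspace_vietoris)
    then have "D \<in> fst ` ?E" by (rule image_eqI[rotated]) simp
    then show False using V(5) by blast
  qed
  let ?F = "{(A, \<alpha>). (A, D, \<alpha>) \<in> R} \<inter> (topspace (vietoris X) \<times> (topspace T - I))"
  have "closedin (prod_topology (vietoris X) T) ?F"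
    using SR_D(7)[OF R D] cI by (intro closedin_Int) (simp_all add: closedin_prod_Times_iff)
  then have "closedin (vietoris X) (fst ` ?F)"
    using closed_map_fst[OF compact] unfolding closed_map_def by blast
  then have "openin (vietoris X) (topspace (vietoris X) - fst ` ?F)" by blast
  moreover have "A \<in> topspace (vietoris X) - fst ` ?F"
    using A DI by (auto simp: topspace_vietoris)
  moreover have "neighbourhood_base_of (closedin (vietoris X)) (vietoris X)"
    unfolding neighbourhood_base_of_closedin
    using compact_exp(1) Hausdorff_exp(1) by (rule compact_Hausdorff_imp_regular_space)
  ultimately obtain \<U> \<C> where U: "openin (vietoris X) \<U>" "closedin (vietoris X) \<C>" "A \<in> \<U>" "\<U> \<subseteq> \<C>"
      "\<C> \<subseteq> topspace (vietoris X) - fst ` ?F"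
    unfolding neighbourhood_base_of by meson
  \<comment> \<open>Deleting a point outside \<open>B\<close> makes the neighbourhood proper, as
    caps require.\<close>
  obtain y where y: "y \<in> topspace Y" "y \<notin> B"
    using B closedin_subset unfolding exp_set_iff by blast
  \<comment> \<open>A closed box of forbidden triples. If R met it at \<open>B'\<close>,
    monotonicity would lift the triple to \<open>D\<close>, where \<open>\<C>\<close> was chosen to
    exclude it.\<close>
  let ?K = "\<C> \<times> {B' \<in> exp_set Y. B' \<subseteq> D} \<times> (topspace T - I)"
  have "closedin P ?K"
    using U(2) V(2) cI by (simp add: closedin_prod_Times_iff closedin_vietoris_subset del: topspace_T)
  moreover have "R \<inter> ?K = {}"
  proof (rule ccontr)
    assume "R \<inter> ?K \<noteq> {}"
    then obtain A' B' \<alpha> where *: "(A', B', \<alpha>) \<in> R" "A' \<in> \<C>" "B' \<subseteq> D" "\<alpha> \<in> topspace T - I" by auto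
    then have "(A', D, \<alpha>) \<in> R"
      using SR_D(2)[OF R *(1) subset_refl *(3) le_refl _ D] SR_D(1)[OF R] by auto
    then have "(A', \<alpha>) \<in> ?F" using * SR_D(1)[OF R] by (auto simp: topspace_vietoris)
    then have "A' \<in> fst ` ?F" by (rule image_eqI[rotated]) simp
    then show False using *(2) U(5) by blast
  qed
  moreover have "openin Y (V - {y})"
    using V(1) Y(2) y by (simp add: openin_diff closedin_Hausdorff_sing_eq)
  moreover have "B \<subseteq> V - {y}" "V - {y} \<noteq> topspace Y" using V(3) y by auto
  moreover have "(A', B', \<alpha>) \<in> ?K"
    if "A' \<in> \<U>" "B' \<in> exp_set Y" "B' \<subseteq> V - {y}" "\<alpha> \<in> carrier L" "\<alpha> \<notin> I" for A' B' \<alpha>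
    using that U(4) V(4) by auto
  ultimately show thesis using U(1,3) that by meson
qed


section \<open>Separating points and closed sets from R^cup\<close>

text \<open>One bound \<open>s\<close> serves all members of \<open>\<A>\<close> at
  \<open>B\<close>, so one interpolated \<open>c\<close> above it caps a whole neighbourhood;
  compactness of \<open>\<A>\<close> reduces the tubes to finitely many. \<open>K\<close> and
  \<open>S\<close> have different tasks: disjointness from \<open>K\<close> will be an open
  condition on representations, whereas containment in \<open>S\<close> is stable under joins and
  still forces \<open>cup Q\<close> to miss \<open>G\<close>.\<close>

lemma point_separation:
  assumes R: "SR R" and mem: "\<A> \<in> exp_set (vietoris X)" "B \<in> exp_set Y" "\<gamma> \<in> carrier L"
    and nin: "(\<A>, B, \<gamma>) \<notin> cup R"
  obtains G S K where "openin Z G" "(\<A>, B, \<gamma>) \<in> G" "SR S" "closedin P K" "R \<inter> K = {}"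
    "\<And>Q. \<lbrakk>SR Q; Q \<inter> K = {}\<rbrakk> \<Longrightarrow> Q \<subseteq> S" "cup S \<inter> G = {}"
proof -
  obtain s where s: "s \<in> carrier L" "\<And>A \<alpha>. \<lbrakk>A \<in> \<A>; (A, B, \<alpha>) \<in> R\<rbrakk> \<Longrightarrow> \<alpha> \<sqsubseteq> s" "\<not> \<gamma> \<sqsubseteq> s"
    using nin mem unfolding rep_cup_iff[OF R] by blast
  obtain c where c: "c \<in> carrier L" "s \<in> interior_below c" "\<not> \<gamma> \<sqsubseteq> c"
    using interpolate[OF mem(3) s(1,3)] .
  have By: "B \<noteq> topspace Y" using rep_cup_top[OF R mem(1,3)] nin by blast
  define good where "good = (\<lambda>A \<U> V K. openin (vietoris X) \<U> \<and> A \<in> \<U> \<and> openin Y V \<and> B \<subseteq> V \<and>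
    V \<noteq> topspace Y \<and> closedin P K \<and> R \<inter> K = {} \<and>
    (\<forall>A' B' \<alpha>. A' \<in> \<U> \<longrightarrow> B' \<in> exp_set Y \<longrightarrow> B' \<subseteq> V \<longrightarrow> \<alpha> \<in> carrier L \<longrightarrow> \<alpha> \<notin> interior_below c \<longrightarrow>
      (A', B', \<alpha>) \<in> K))"
  have "\<exists>\<U> V K. good A \<U> V K" if A: "A \<in> \<A>" for A
  proof -
    \<comment> \<open>Every value at \<open>A\<close> is below \<open>s\<close>, and
      \<open>interior_below c\<close> is closed downwards; it is thus an admissible open set
      \<open>I\<close> for \<open>tube\<close>.\<close>
    have "\<alpha> \<in> interior_below c" if "(A, B, \<alpha>) \<in> R" for \<alpha>
      using interior_below_lower[OF c(2) s(2)[OF A that] _ c(1)] that SR_D(1)[OF R] by blast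
    then obtain \<U> V K where "openin (vietoris X) \<U>" "A \<in> \<U>" "openin Y V" "B \<subseteq> V" "V \<noteq> topspace Y"
      "closedin P K" "R \<inter> K = {}"
      "\<And>A' B' \<alpha>. \<lbrakk>A' \<in> \<U>; B' \<in> exp_set Y; B' \<subseteq> V; \<alpha> \<in> carrier L; \<alpha> \<notin> interior_below c\<rbrakk>
        \<Longrightarrow> (A', B', \<alpha>) \<in> K"
      using tube[OF R exp2_subset[OF mem(1) A] mem(2) By openin_interior_below] by metis
    then have "good A \<U> V K" unfolding good_def by (intro conjI allI impI)
    then show ?thesis by (intro exI)
  qed
  then obtain U V K where good: "\<And>A. A \<in> \<A> \<Longrightarrow> good A (U A) (V A) (K A)" by metis
  have UVK: "openin (vietoris X) (U A)" "A \<in> U A" "openin Y (V A)" "B \<subseteq> V A" "V A \<noteq> topspace Y"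
    "closedin P (K A)" "R \<inter> K A = {}" if "A \<in> \<A>" for A
    using good[OF that] unfolding good_def by - (elim conjE, assumption)+
  have UVK8: "(A', B', \<alpha>) \<in> K A"
    if "A \<in> \<A>" "A' \<in> U A" "B' \<in> exp_set Y" "B' \<subseteq> V A" "\<alpha> \<in> carrier L" "\<alpha> \<notin> interior_below c" for A A' B' \<alpha>
    using good[OF that(1)] that(2-) unfolding good_def by (elim conjE) (drule spec mp | assumption)+
  have "compactin (vietoris X) \<A>"
    using mem(1) compact_exp(1) by (simp add: closedin_compact_space exp_set_iff)
  moreover have "\<A> \<subseteq> \<Union>(U ` \<A>)" using UVK(2) by blast
  ultimately obtain \<F> where F0: "finite \<F>" "\<F> \<subseteq> U ` \<A>" "\<A> \<subseteq> \<Union>\<F>"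
    using compactinD[of "vietoris X" \<A> "U ` \<A>"] UVK(1) by auto
  from finite_subset_image[OF F0(1,2)] obtain F where F: "F \<subseteq> \<A>" "finite F" "\<F> = U ` F"
    by (elim exE conjE)
  \<comment> \<open>\<open>V'\<close> is an intersection indexed by \<open>F\<close>, so
    \<open>F\<close> has to be non-empty.\<close>
  have "\<A> \<noteq> {}" using mem(1) by (simp add: exp_set_iff)
  then have Fne: "F \<noteq> {}" using F0(3) F(3) by auto
  define U' where "U' = \<Union>(U ` F)"
  define V' where "V' = \<Inter>(V ` F)"
  define K' where "K' = \<Union>(K ` F)"
  have oU: "openin (vietoris X) U'" unfolding U'_def using UVK(1) F(1) by blast
  have oV: "openin Y V'" unfolding V'_def using UVK(3) F(1,2) Fne by (intro openin_Inter) auto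
  obtain A0 where "A0 \<in> F" using Fne by blast
  then have "V' \<subseteq> V A0" "openin Y (V A0)" "V A0 \<noteq> topspace Y" "A0 \<in> \<A>"
    using UVK(3,5) F(1) unfolding V'_def by auto
  then have V'Y: "V' \<noteq> topspace Y" using openin_subset[of Y "V A0"] by blast
  have U'X: "U' \<subseteq> exp_set X" using openin_subset[OF oU] by (simp add: topspace_vietoris)
  let ?S = "capped U' V' c"
  let ?G = "{\<A>' \<in> exp_set (vietoris X). \<A>' \<subseteq> U'} \<times> {B' \<in> exp_set Y. B' \<subseteq> V'} \<times> {\<alpha> \<in> carrier L. \<not> \<alpha> \<sqsubseteq> c}"
  have SRS: "SR ?S" using SR_capped[OF oU oV V'Y c(1)] .
  show thesis
  proof (rule that[of ?G ?S K'])
    show "openin Z ?G"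
      using oU oV c(1) by (intro openin_prod_Times_iff[THEN iffD2] disjI2 conjI openin_vietoris_subset openin_not_le)
    show "(\<A>, B, \<gamma>) \<in> ?G"
    proof -
      have "\<A> \<subseteq> U'" using F0(3) F(3) unfolding U'_def by simp
      moreover have "B \<subseteq> V'" unfolding V'_def using F(1) UVK(4) by blast
      ultimately show ?thesis using mem c(3) by simp
    qed
    show "closedin P K'"
      unfolding K'_def using F(1,2) UVK(6) by (intro closedin_Union) auto
    show "R \<inter> K' = {}"
      unfolding K'_def using F(1) UVK(7) by blast
    show "Q \<subseteq> ?S" if Q: "SR Q" "Q \<inter> K' = {}" for Q
      unfolding subset_capped_iff[OF Q(1) U'X]
    proof (intro allI impI, elim conjE)
      fix A B \<alpha> assume *: "A \<in> U'" "B \<subseteq> V'" "(A, B, \<alpha>) \<in> Q"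
      then obtain A1 where A1: "A1 \<in> F" "A \<in> U A1" unfolding U'_def by blast
      have "B \<subseteq> V A1" using *(2) A1(1) unfolding V'_def by blast
      moreover have "B \<in> exp_set Y" "\<alpha> \<in> carrier L" using *(3) SR_D(1)[OF Q(1)] by auto
      moreover have "(A, B, \<alpha>) \<notin> K A1" using *(3) Q(2) A1(1) unfolding K'_def by blast
      ultimately have "\<alpha> \<in> interior_below c" using UVK8[of A1 A B \<alpha>] A1 F(1) by blast
      then show "\<alpha> \<sqsubseteq> c" using interior_below_le by blast
    qed
    show "cup ?S \<inter> ?G = {}"
    proof (rule ccontr)
      assume "cup ?S \<inter> ?G \<noteq> {}"
      then obtain \<A>' B' \<alpha> where *: "(\<A>', B', \<alpha>) \<in> cup ?S" "\<A>' \<subseteq> U'" "B' \<subseteq> V'" "\<not> \<alpha> \<sqsubseteq> c" by auto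
      have "\<forall>A\<in>\<A>'. \<forall>\<alpha>. (A, B', \<alpha>) \<in> ?S \<longrightarrow> \<alpha> \<sqsubseteq> c"
        using *(2,3) unfolding capped_def by blast
      then show False using *(1,4) c(1) unfolding rep_cup_iff[OF SRS] by blast
    qed
  qed (rule SRS)
qed

text \<open>The case \<open>Q = R\<close> of \<open>point_separation\<close>: \<open>cup R\<close>
  lies in \<open>cup S\<close>, which misses the neighbourhood \<open>G\<close>.\<close>

lemma closedin_rep_cup:
  assumes R: "SR R" shows "closedin Z (cup R)"
proof -
  have sub: "cup R \<subseteq> topspace Z" unfolding topspace_Z rep_cup_def by auto
  have "openin Z (topspace Z - cup R)"
  proof (subst openin_subopen, intro ballI)
    fix z assume z: "z \<in> topspace Z - cup R"
    obtain \<A> B \<gamma> where zz: "z = (\<A>, B, \<gamma>)" by (cases z)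
    have mem: "\<A> \<in> exp_set (vietoris X)" "B \<in> exp_set Y" "\<gamma> \<in> carrier L" "(\<A>, B, \<gamma>) \<notin> cup R"
      using z unfolding topspace_Z zz by auto
    obtain G S K where G: "openin Z G" "(\<A>, B, \<gamma>) \<in> G" "SR S" "R \<inter> K = {}"
        "\<And>Q. \<lbrakk>SR Q; Q \<inter> K = {}\<rbrakk> \<Longrightarrow> Q \<subseteq> S" "cup S \<inter> G = {}"
      using point_separation[OF R mem] by metis
    have "cup R \<subseteq> cup S" using rep_cup_mono[OF R G(3)] G(5)[OF R G(4)] .
    then have "G \<subseteq> topspace Z - cup R" using G(6) openin_subset[OF G(1)] by blast
    then show "\<exists>W. openin Z W \<and> z \<in> W \<and> W \<subseteq> topspace Z - cup R"
      using G(1,2) zz by blast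
  qed
  then show ?thesis using sub by (simp add: closedin_def)
qed

lemma rep_cup_exp:
  assumes R: "SR R" shows "cup R \<in> exp_set Z"
proof -
  have "topspace (vietoris X) \<noteq> {}"
    using topspace_in_exp_set[OF X(3)] by (auto simp: topspace_vietoris)
  then have "(topspace (vietoris X), topspace Y, \<bottom>) \<in> cup R"
    using rep_cup_top[OF R topspace_in_exp_set] bottom(1) by blast
  then show ?thesis using closedin_rep_cup[OF R] by (auto simp: exp_set_iff)
qed

text \<open>Finitely many boxes \<open>G z\<close> cover the compact set \<open>K\<close>. Uniting
  the forbidden sets and intersecting the representations \<open>S z\<close> works because
  \<open>cup\<close> is monotone, so the \<open>cup\<close> of the intersection misses each chosen
  box.\<close>

lemma avoidance:
  assumes R: "SR R" and K: "closedin Z K" "cup R \<inter> K = {}"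
  obtains S K' where "SR S" "closedin P K'" "R \<inter> K' = {}"
    "\<And>Q. \<lbrakk>SR Q; Q \<inter> K' = {}\<rbrakk> \<Longrightarrow> Q \<subseteq> S" "cup S \<inter> K = {}"
proof -
  define good where "good = (\<lambda>z G S K'. openin Z G \<and> z \<in> G \<and> SR S \<and> closedin P K' \<and> R \<inter> K' = {} \<and>
    (\<forall>Q. SR Q \<longrightarrow> Q \<inter> K' = {} \<longrightarrow> Q \<subseteq> S) \<and> cup S \<inter> G = {})"
  have "\<exists>G S K'. good z G S K'" if z: "z \<in> K" for z
  proof -
    obtain \<A> B \<gamma> where zz: "z = (\<A>, B, \<gamma>)" by (cases z)
    have mem: "\<A> \<in> exp_set (vietoris X)" "B \<in> exp_set Y" "\<gamma> \<in> carrier L" "(\<A>, B, \<gamma>) \<notin> cup R"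
      using z K(2) closedin_subset[OF K(1)] unfolding topspace_Z zz by auto
    obtain G S K' where "openin Z G" "z \<in> G" "SR S" "closedin P K'" "R \<inter> K' = {}"
      "\<And>Q. \<lbrakk>SR Q; Q \<inter> K' = {}\<rbrakk> \<Longrightarrow> Q \<subseteq> S" "cup S \<inter> G = {}"
      unfolding zz using point_separation[OF R mem] by metis
    then have "good z G S K'" unfolding good_def by (intro conjI allI impI)
    then show ?thesis by (intro exI)
  qed
  then obtain G S H where good: "\<And>z. z \<in> K \<Longrightarrow> good z (G z) (S z) (H z)" by metis
  have g: "openin Z (G z)" "z \<in> G z" "SR (S z)" "closedin P (H z)" "R \<inter> H z = {}" "cup (S z) \<inter> G z = {}"
    if "z \<in> K" for z
    using good[OF that] unfolding good_def by - (elim conjE, assumption)+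
  have g7: "Q \<subseteq> S z" if "z \<in> K" "SR Q" "Q \<inter> H z = {}" for z Q
    using good[OF that(1)] that(2,3) unfolding good_def by (elim conjE) (drule spec mp | assumption)+
  have "compactin Z K" using K(1) compact_Z by (simp add: closedin_compact_space)
  moreover have "K \<subseteq> \<Union>(G ` K)" using g(2) by blast
  moreover have "openin Z W" if "W \<in> G ` K" for W using that g(1) by blast
  ultimately obtain \<F> where F0: "finite \<F>" "\<F> \<subseteq> G ` K" "K \<subseteq> \<Union>\<F>"
    using compactinD[of Z K "G ` K"] by meson
  from finite_subset_image[OF F0(1,2)] obtain F where F: "F \<subseteq> K" "finite F" "\<F> = G ` F"
    by (elim exE conjE)
  \<comment> \<open>The largest representation is inserted so that the family is non-empty even if
    \<open>F\<close> is empty.\<close>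
  let ?M = "insert (exp_set X \<times> exp_set Y \<times> carrier L) (S ` F)"
  show thesis
  proof (rule that[of "\<Inter>?M" "\<Union>(H ` F)"])
    show S: "SR (\<Inter>?M)" using g(3) F(1) SR_top by (intro SR_Inter) auto
    show "closedin P (\<Union>(H ` F))" using g(4) F(1,2) by (intro closedin_Union) auto
    show "R \<inter> \<Union>(H ` F) = {}" using g(5) F(1) by blast
    show "Q \<subseteq> \<Inter>?M" if "SR Q" "Q \<inter> \<Union>(H ` F) = {}" for Q
    proof -
      have "Q \<subseteq> S z" if "z \<in> F" for z
        using g7[of z Q] that F(1) \<open>SR Q\<close> \<open>Q \<inter> \<Union>(H ` F) = {}\<close> by blast
      then show ?thesis using SR_D(1)[OF \<open>SR Q\<close>] by blast
    qed
    show "cup (\<Inter>?M) \<inter> K = {}"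
    proof (rule ccontr)
      assume "cup (\<Inter>?M) \<inter> K \<noteq> {}"
      then obtain w where w: "w \<in> cup (\<Inter>?M)" "w \<in> K" by blast
      then obtain z where z: "z \<in> F" "w \<in> G z" using F0(3) F(3) by blast
      have "\<Inter>?M \<subseteq> S z" using z(1) by blast
      then have "w \<in> cup (S z)" using rep_cup_mono[OF S g(3)] z F(1) w(1) by blast
      then show False using g(6) z F(1) by blast
    qed
  qed
qed

section \<open>The topology on the set of strict ambiguous representations\<close>

abbreviation C where "C \<equiv> CSAmb X Y T L"
abbreviation \<tau> where "\<tau> \<equiv> CSAmb_topology X Y T L"

lemma carrier_C [simp]: "carrier C = Collect SR"
  by (simp add: CSAmb_def)

lemma openin_\<tau>: "openin \<tau> N \<longleftrightarrow> (\<exists>\<V>. openin (vietoris Z) \<V> \<and> N = {R. SR R \<and> cup R \<in> \<V>})"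
  unfolding CSAmb_topology_def cup_hyperspace_def openin_pullback_topology vimage_def carrier_C
  by (simp add: Int_def conj_commute)

lemma topspace_\<tau>: "topspace \<tau> = Collect SR"
  unfolding CSAmb_topology_def cup_hyperspace_def topspace_pullback_topology topspace_vietoris
  using rep_cup_exp by auto

section \<open>Subbasic open sets and neighbourhoods\<close>

text \<open>The embedding \<open>(A, p) \<mapsto> ({A}, p)\<close> sends \<open>K\<close> to a
  compact, hence closed, subset of \<open>Z\<close>. By \<open>rep_cup_sing\<close> R misses
  \<open>K\<close> iff \<open>cup R\<close> misses the image.\<close>

lemma openin_avoiding:
  assumes K: "closedin P K" shows "openin \<tau> {R. SR R \<and> R \<inter> K = {}}"
proof -
  define f where "f = (\<lambda>(A :: 'a set, p :: 'b set \<times> 'l). ({A}, p))"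
  have "continuous_map P (vietoris (vietoris X)) (\<lambda>p. {fst p})"
    using continuous_map_compose[OF continuous_map_fst continuous_map_vietoris_sing[OF Hausdorff_exp(1)]]
    by (simp add: o_def)
  then have "continuous_map P Z f"
    using continuous_map_snd[of "vietoris X" "prod_topology (vietoris Y) T"]
    by (simp add: continuous_map_pairwise o_def f_def split_def)
  then have "compactin Z (f ` K)"
    using image_compactin K compact_P closedin_compact_space by metis
  then have "closedin Z (f ` K)" using Hausdorff_Z compactin_imp_closedin by blast
  then have "openin (vietoris Z) {F \<in> exp_set Z. F \<subseteq> topspace Z - f ` K}"
    by (intro openin_vietoris_subset) blast
  moreover have "{R. SR R \<and> R \<inter> K = {}} = {R. SR R \<and> cup R \<in> {F \<in> exp_set Z. F \<subseteq> topspace Z - f ` K}}"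
  proof -
    have "R \<inter> K = {} \<longleftrightarrow> cup R \<inter> f ` K = {}" if R: "SR R" for R
    proof -
      have "f x \<in> cup R \<longleftrightarrow> x \<in> R" if "x \<in> K" for x
      proof -
        obtain A B \<alpha> where x: "x = (A, B, \<alpha>)" by (cases x)
        have "A \<in> exp_set X" using closedin_subset[OF K] that x unfolding topspace_P by blast
        then show ?thesis using rep_cup_sing[OF R, of A B \<alpha>] x by (simp add: f_def)
      qed
      then show ?thesis by blast
    qed
    moreover have "cup R \<in> exp_set Z \<and> cup R \<subseteq> topspace Z" if "SR R" for R
      using rep_cup_exp[OF that] closedin_subset[OF closedin_rep_cup[OF that]] by blast
    ultimately show ?thesis by blast
  qed
  ultimately show ?thesis unfolding openin_\<tau> by blast
qed

definition caps :: "('a set \<times> 'b set \<times> 'l) set set" where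
  "caps = {capped \<U> V c |\<U> V c. openin (vietoris X) \<U> \<and> openin Y V \<and> V \<noteq> topspace Y \<and> c \<in> carrier L}"

lemma SR_caps: "H \<in> caps \<Longrightarrow> SR H"
  unfolding caps_def using SR_capped by blast

lemma closedin_caps: "H \<in> caps \<Longrightarrow> closedin P H"
  unfolding caps_def using closedin_capped by blast

text \<open>Failing to lie under the cap is a single hit condition on the box \<open>?G\<close>: a
  bound \<open>c\<close> on all values over \<open>\<U>\<close> passes to suprema, and conversely a
  violating triple enters \<open>cup R\<close> over a singleton.\<close>

lemma openin_not_subset_caps:
  assumes "H \<in> caps" shows "openin \<tau> {R. SR R \<and> \<not> R \<subseteq> H}"
proof -
  obtain \<U> V c where H: "H = capped \<U> V c" "openin (vietoris X) \<U>" "openin Y V" "c \<in> carrier L"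
    using assms unfolding caps_def by blast
  have UX: "\<U> \<subseteq> exp_set X" using openin_subset[OF H(2)] by (simp add: topspace_vietoris)
  let ?G = "{\<A> \<in> exp_set (vietoris X). \<A> \<subseteq> \<U>} \<times> {B \<in> exp_set Y. B \<subseteq> V} \<times> {\<alpha> \<in> carrier L. \<not> \<alpha> \<sqsubseteq> c}"
  have "openin Z ?G"
    using H(2-4) by (intro openin_prod_Times_iff[THEN iffD2] disjI2 conjI openin_vietoris_subset openin_not_le)
  then have "openin (vietoris Z) {F \<in> exp_set Z. F \<inter> ?G \<noteq> {}}"
    by (rule openin_vietoris_meets)
  moreover have "R \<subseteq> H \<longleftrightarrow> cup R \<inter> ?G = {}" if R: "SR R" for R
    unfolding H(1) subset_capped_iff[OF R UX]
  proof
    assume r: "\<forall>A B \<alpha>. A \<in> \<U> \<and> B \<subseteq> V \<and> (A, B, \<alpha>) \<in> R \<longrightarrow> \<alpha> \<sqsubseteq> c"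
    have "\<gamma> \<sqsubseteq> c" if "(\<A>, B, \<gamma>) \<in> cup R" "\<A> \<subseteq> \<U>" "B \<subseteq> V" for \<A> B \<gamma>
    proof -
      have "\<forall>A\<in>\<A>. \<forall>\<alpha>. (A, B, \<alpha>) \<in> R \<longrightarrow> \<alpha> \<sqsubseteq> c" using r that by blast
      then show ?thesis using that(1) H(4) unfolding rep_cup_iff[OF R] by blast
    qed
    then show "cup R \<inter> ?G = {}" by auto
  next
    assume e: "cup R \<inter> ?G = {}"
    show "\<forall>A B \<alpha>. A \<in> \<U> \<and> B \<subseteq> V \<and> (A, B, \<alpha>) \<in> R \<longrightarrow> \<alpha> \<sqsubseteq> c"
    proof (intro allI impI, elim conjE, rule ccontr)
      fix A B \<alpha> assume *: "A \<in> \<U>" "B \<subseteq> V" "(A, B, \<alpha>) \<in> R" "\<not> \<alpha> \<sqsubseteq> c"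
      have m: "A \<in> exp_set X" "B \<in> exp_set Y" "\<alpha> \<in> carrier L" using *(3) SR_D(1)[OF R] by auto
      have "({A}, B, \<alpha>) \<in> cup R" using rep_cup_sing[OF R m(1)] *(3) by simp
      moreover have "({A}, B, \<alpha>) \<in> ?G" using * m sing_exp2 by simp
      ultimately show False using e by blast
    qed
  qed
  then have "{R. SR R \<and> \<not> R \<subseteq> H} = {R. SR R \<and> cup R \<in> {F \<in> exp_set Z. F \<inter> ?G \<noteq> {}}}"
    using rep_cup_exp by blast
  ultimately show ?thesis unfolding openin_\<tau> by blast
qed

text \<open>Shrink \<open>G\<close> to a box around a point of \<open>cup R\<close> and apply
  \<open>finite_bounds\<close> to its last factor. Each resulting cap that Q escapes contributes a
  triple of Q. All of them are merged into one point of \<open>cup Q\<close> in the box: first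
  coordinates are added to \<open>\<A>\<close>, second ones united with \<open>B\<close>, and the
  supremum exceeds no longer just one bound but none of the \<open>c\<close> lies above it.\<close>

lemma meeting_nbhd:
  assumes R: "SR R" and G: "openin Z G" "cup R \<inter> G \<noteq> {}"
  obtains \<H> where "finite \<H>" "\<H> \<subseteq> caps" "\<And>H. H \<in> \<H> \<Longrightarrow> \<not> R \<subseteq> H"
    "\<And>Q. \<lbrakk>SR Q; \<And>H. H \<in> \<H> \<Longrightarrow> \<not> Q \<subseteq> H\<rbrakk> \<Longrightarrow> cup Q \<inter> G \<noteq> {}"
proof -
  obtain \<A> B \<gamma> where z: "(\<A>, B, \<gamma>) \<in> cup R" "(\<A>, B, \<gamma>) \<in> G" using G(2) by auto
  then have mem: "\<A> \<in> exp_set (vietoris X)" "B \<in> exp_set Y" "\<gamma> \<in> carrier L"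
    unfolding rep_cup_iff[OF R] by blast+
  obtain \<P> \<W> where 1: "openin (vietoris (vietoris X)) \<P>" "openin (prod_topology (vietoris Y) T) \<W>"
    "\<A> \<in> \<P>" "(B, \<gamma>) \<in> \<W>" "\<P> \<times> \<W> \<subseteq> G"
    using G(1) z(2) unfolding openin_prod_topology_alt[of "vietoris (vietoris X)"] by meson
  obtain \<Q> W where 2: "openin (vietoris Y) \<Q>" "openin T W" "B \<in> \<Q>" "\<gamma> \<in> W" "\<Q> \<times> W \<subseteq> \<W>"
    using 1(2,4) unfolding openin_prod_topology_alt by meson
  obtain \<U> where U: "\<And>U. U \<in> \<U> \<Longrightarrow> openin (vietoris X) U"
    "\<A> \<in> vietoris_basic (vietoris X) \<U>" "vietoris_basic (vietoris X) \<U> \<subseteq> \<P>"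
    using vietoris_basic_nbhd[OF 1(1,3)] by metis
  obtain \<V> where V: "\<And>U. U \<in> \<V> \<Longrightarrow> openin Y U" "B \<in> vietoris_basic Y \<V>" "vietoris_basic Y \<V> \<subseteq> \<Q>"
    using vietoris_basic_nbhd[OF 2(1,3)] by metis
  have box: "(\<A>', B', w) \<in> G" if "\<A>' \<in> vietoris_basic (vietoris X) \<U>" "B' \<in> vietoris_basic Y \<V>" "w \<in> W" for \<A>' B' w
    using that 1(5) 2(5) U(3) V(3) by blast
  have AU: "\<A> \<subseteq> \<Union>\<U>" and BV: "B \<subseteq> \<Union>\<V>" using U(2) V(2) by (simp_all add: vietoris_basic_def)
  have oU: "openin (vietoris X) (\<Union>\<U>)" and oV: "openin Y (\<Union>\<V>)" using U(1) V(1) by blast+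
  have UX: "\<Union>\<U> \<subseteq> exp_set X" using openin_subset[OF oU] by (simp add: topspace_vietoris)
  have grow_A: "\<A> \<union> \<E> \<in> vietoris_basic (vietoris X) \<U>" if "finite \<E>" "\<E> \<subseteq> \<Union>\<U>" for \<E>
  proof (cases "\<E> = {}")
    case False
    then have "\<E> \<in> exp_set (vietoris X)"
      using that UX Hausdorff_exp(1) by (intro finite_in_exp_set) (auto simp: topspace_vietoris)
    then have "\<A> \<union> \<E> \<in> exp_set (vietoris X)" using mem(1) by (rule exp_set_Un[rotated])
    moreover have "\<forall>U\<in>\<U>. (\<A> \<union> \<E>) \<inter> U \<noteq> {}" using U(2) unfolding vietoris_basic_def by blast
    ultimately show ?thesis using AU that(2) by (simp add: vietoris_basic_def)
  qed (use U(2) in simp)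
  have grow_B: "B' \<in> vietoris_basic Y \<V>" if "B' \<in> exp_set Y" "B \<subseteq> B'" "B' \<subseteq> \<Union>\<V>" for B'
  proof -
    have "\<forall>U\<in>\<V>. B' \<inter> U \<noteq> {}" using V(2) that(2) unfolding vietoris_basic_def by blast
    then show ?thesis using that by (simp add: vietoris_basic_def)
  qed
  show thesis
  proof (cases "\<Union>\<V> = topspace Y")
    case True
    \<comment> \<open>No proper cap exists over this \<open>\<V>\<close>, but none is needed: every
      \<open>cup Q\<close> contains a point of \<open>G\<close> over \<open>topspace Y\<close>, so
      the empty family of caps works.\<close>
    have "topspace Y \<in> vietoris_basic Y \<V>"
      using True BV topspace_Y_exp by (intro grow_B) auto
    then have "(\<A>, topspace Y, \<gamma>) \<in> G" using box U(2) 2(4) by blast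
    moreover have "(\<A>, topspace Y, \<gamma>) \<in> cup Q" if "SR Q" for Q
      using rep_cup_top[OF that mem(1,3)] .
    ultimately show thesis using that[of "{}"] by blast
  next
    case False
    obtain D where D: "finite D" "D \<subseteq> carrier L" "\<And>c. c \<in> D \<Longrightarrow> \<not> \<gamma> \<sqsubseteq> c"
      "\<And>x. \<lbrakk>x \<in> carrier L; \<And>c. c \<in> D \<Longrightarrow> \<not> x \<sqsubseteq> c\<rbrakk> \<Longrightarrow> \<exists>w\<in>W. w \<sqsubseteq> x"
      using finite_bounds[OF 2(2,4)] by metis
    show thesis
    proof (rule that[of "capped (\<Union>\<U>) (\<Union>\<V>) ` D"])
      show "finite (capped (\<Union>\<U>) (\<Union>\<V>) ` D)" using D(1) by simp
      show "capped (\<Union>\<U>) (\<Union>\<V>) ` D \<subseteq> caps"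
      proof (intro image_subsetI)
        fix c assume "c \<in> D"
        then have "c \<in> carrier L" using D(2) by blast
        then show "capped (\<Union>\<U>) (\<Union>\<V>) c \<in> caps"
          using oU oV False unfolding caps_def
            by (intro CollectI exI[of _ "\<Union>\<U>"] exI[of _ "\<Union>\<V>"] exI[of _ c]) simp
      qed
      show "\<not> R \<subseteq> H" if "H \<in> capped (\<Union>\<U>) (\<Union>\<V>) ` D" for H
      proof
        assume "R \<subseteq> H"
        from that obtain c where c: "c \<in> D" "H = capped (\<Union>\<U>) (\<Union>\<V>) c" by blast
        then have "\<forall>A B \<alpha>. A \<in> \<Union>\<U> \<and> B \<subseteq> \<Union>\<V> \<and> (A, B, \<alpha>) \<in> R \<longrightarrow> \<alpha> \<sqsubseteq> c"
          using \<open>R \<subseteq> H\<close> subset_capped_iff[OF R UX] by simp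
        then have "\<forall>A\<in>\<A>. \<forall>\<alpha>. (A, B, \<alpha>) \<in> R \<longrightarrow> \<alpha> \<sqsubseteq> c" using AU BV by blast
        then have "\<gamma> \<sqsubseteq> c" using z(1) c(1) D(2) unfolding rep_cup_iff[OF R] by blast
        then show False using D(3) c(1) by blast
      qed
      fix Q assume Q: "SR Q" and H: "\<And>H. H \<in> capped (\<Union>\<U>) (\<Union>\<V>) ` D \<Longrightarrow> \<not> Q \<subseteq> H"
      have "\<forall>c\<in>D. \<exists>A B \<alpha>. A \<in> \<Union>\<U> \<and> B \<subseteq> \<Union>\<V> \<and> (A, B, \<alpha>) \<in> Q \<and> \<not> \<alpha> \<sqsubseteq> c"
      proof
        fix c assume "c \<in> D"
        then have "\<not> Q \<subseteq> capped (\<Union>\<U>) (\<Union>\<V>) c" by (intro H imageI)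
        then show "\<exists>A B \<alpha>. A \<in> \<Union>\<U> \<and> B \<subseteq> \<Union>\<V> \<and> (A, B, \<alpha>) \<in> Q \<and> \<not> \<alpha> \<sqsubseteq> c"
          unfolding subset_capped_iff[OF Q UX] by blast
      qed
      then obtain a b e where abe: "\<And>c. c \<in> D \<Longrightarrow> a c \<in> \<Union>\<U>" "\<And>c. c \<in> D \<Longrightarrow> b c \<subseteq> \<Union>\<V>"
        "\<And>c. c \<in> D \<Longrightarrow> (a c, b c, e c) \<in> Q" "\<And>c. c \<in> D \<Longrightarrow> \<not> e c \<sqsubseteq> c"
        by metis
      \<comment> \<open>Keeping \<open>\<A>\<close> and \<open>B\<close> inside the enlarged sets
        preserves the hit conditions of the two basic neighbourhoods.\<close>
      let ?A = "\<A> \<union> a ` D" and ?B = "B \<union> \<Union>(b ` D)"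
      have bc: "b c \<in> exp_set Y" "e c \<in> carrier L" "a c \<in> exp_set X" if "c \<in> D" for c
        using abe(3)[OF that] SR_D(1)[OF Q] by auto
      have "closedin Y (\<Union>(b ` D))" using bc(1) D(1) by (intro closedin_Union) (auto simp: exp_set_iff)
      then have Bexp: "?B \<in> exp_set Y" using mem(2) by (auto simp: exp_set_iff)
      then have Bb: "?B \<in> vietoris_basic Y \<V>" using BV abe(2) by (intro grow_B) auto
      have Ab: "?A \<in> vietoris_basic (vietoris X) \<U>" using D(1) abe(1) by (intro grow_A) auto
      then have Aexp: "?A \<in> exp_set (vietoris X)" by (simp add: vietoris_basic_def)
      have eQ: "(a c, ?B, e c) \<in> Q" if "c \<in> D" for c
        using SR_D(2)[OF Q abe(3)[OF that] subset_refl _ le_refl[OF bc(2)[OF that]] bc(3)[OF that] Bexp bc(2)[OF that]]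
          that by blast
      let ?S = "{\<alpha> \<in> carrier L. \<exists>A\<in>?A. (A, ?B, \<alpha>) \<in> Q}"
      obtain A0 where A0: "A0 \<in> ?A" using Aexp unfolding exp_set_iff by blast
      \<comment> \<open>\<open>D\<close> may be empty, so the set of values gets its guaranteed
        element from the bottom.\<close>
      then have "(A0, ?B, \<bottom>) \<in> Q" using SR_D(5)[OF Q exp2_subset[OF Aexp] Bexp] by blast
      then have "?S \<noteq> {}" using A0 bottom(1) by blast
      then have sup: "\<Squnion>?S \<in> carrier L" "\<And>u. u \<in> carrier L \<Longrightarrow> \<Squnion>?S \<sqsubseteq> u \<longleftrightarrow> (\<forall>a\<in>?S. a \<sqsubseteq> u)"
        using Sup_le_iff[of ?S] by auto
      have "\<not> \<Squnion>?S \<sqsubseteq> c" if "c \<in> D" for c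
      proof -
        have "e c \<in> ?S" using eQ[OF that] bc(2)[OF that] that by blast
        then show ?thesis using sup(2)[of c] abe(4)[OF that] D(2) that by blast
      qed
      then obtain w where w: "w \<in> W" "w \<sqsubseteq> \<Squnion>?S" using D(4)[OF sup(1)] by blast
      have "w \<in> carrier L" using w(1) openin_subset[OF 2(2)] by auto
      then have "(?A, ?B, w) \<in> cup Q" using w(2) Aexp Bexp unfolding rep_cup_def by blast
      moreover have "(?A, ?B, w) \<in> G" using box[OF Ab Bb w(1)] .
      ultimately show "cup Q \<inter> G \<noteq> {}" by blast
    qed
  qed
qed


text \<open>\<open>avoidance\<close> treats the complement of the union of \<open>\<G>\<close>, and
  \<open>meeting_nbhd\<close> each member of \<open>\<G>\<close>. Two miss conditions are recorded:
  the open one with \<open>K\<close>, and the weaker containment in \<open>S\<close>, which already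
  gives membership in \<open>N\<close> since \<open>cup\<close> is monotone.\<close>

lemma nbhd_form:
  assumes N: "openin \<tau> N" "R \<in> N"
  obtains \<H> S K where "finite \<H>" "\<H> \<subseteq> caps" "\<And>H. H \<in> \<H> \<Longrightarrow> \<not> R \<subseteq> H" "SR S" "closedin P K" "R \<inter> K = {}"
    "\<And>Q. \<lbrakk>SR Q; Q \<inter> K = {}\<rbrakk> \<Longrightarrow> Q \<subseteq> S"
    "\<And>Q. \<lbrakk>SR Q; Q \<subseteq> S; \<And>H. H \<in> \<H> \<Longrightarrow> \<not> Q \<subseteq> H\<rbrakk> \<Longrightarrow> Q \<in> N"
proof -
  obtain \<V> where V: "openin (vietoris Z) \<V>" "N = {R. SR R \<and> cup R \<in> \<V>}"
    using N(1) unfolding openin_\<tau> by blast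
  then have R: "SR R" "cup R \<in> \<V>" using N(2) by auto
  obtain \<G> where G: "finite \<G>" "\<And>G. G \<in> \<G> \<Longrightarrow> openin Z G" "cup R \<in> vietoris_basic Z \<G>" "vietoris_basic Z \<G> \<subseteq> \<V>"
    using vietoris_basic_nbhd[OF V(1) R(2)] by metis
  have "closedin Z (topspace Z - \<Union>\<G>)" using G(2) by blast
  moreover have "cup R \<inter> (topspace Z - \<Union>\<G>) = {}" using G(3) unfolding vietoris_basic_def by blast
  ultimately obtain S K where S: "SR S" "closedin P K" "R \<inter> K = {}"
    "\<And>Q. \<lbrakk>SR Q; Q \<inter> K = {}\<rbrakk> \<Longrightarrow> Q \<subseteq> S" "cup S \<inter> (topspace Z - \<Union>\<G>) = {}"
    using avoidance[OF R(1)] by metis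
  define good where "good = (\<lambda>G \<H>. finite \<H> \<and> \<H> \<subseteq> caps \<and> (\<forall>H\<in>\<H>. \<not> R \<subseteq> H) \<and>
    (\<forall>Q. SR Q \<longrightarrow> (\<forall>H\<in>\<H>. \<not> Q \<subseteq> H) \<longrightarrow> cup Q \<inter> G \<noteq> {}))"
  have "\<exists>\<H>. good G \<H>" if "G \<in> \<G>" for G
  proof -
    have "cup R \<inter> G \<noteq> {}" using G(3) that unfolding vietoris_basic_def by blast
    from meeting_nbhd[OF R(1) G(2)[OF that] this] show ?thesis unfolding good_def by metis
  qed
  then obtain h where h: "\<And>G. G \<in> \<G> \<Longrightarrow> good G (h G)" by metis
  show thesis
  proof (rule that[of "\<Union>(h ` \<G>)" S K])
    show "finite (\<Union>(h ` \<G>))" using G(1) h unfolding good_def by blast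
    show "\<Union>(h ` \<G>) \<subseteq> caps" using h unfolding good_def by blast
    show "\<not> R \<subseteq> H" if "H \<in> \<Union>(h ` \<G>)" for H using h that unfolding good_def by blast
    show "Q \<in> N" if Q: "SR Q" "Q \<subseteq> S" and H: "\<And>H. H \<in> \<Union>(h ` \<G>) \<Longrightarrow> \<not> Q \<subseteq> H" for Q
    proof -
      have "cup Q \<inter> G \<noteq> {}" if "G \<in> \<G>" for G
        using h[OF that] H that Q(1) unfolding good_def by blast
      moreover have "cup Q \<in> exp_set Z" using rep_cup_exp[OF Q(1)] .
      moreover have "cup Q \<subseteq> \<Union>\<G>"
        using rep_cup_mono[OF Q(1) S(1) Q(2)] S(5) closedin_subset[OF closedin_rep_cup[OF S(1)]] by blast
      ultimately have "cup Q \<in> vietoris_basic Z \<G>" by (simp add: vietoris_basic_def)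
      then show ?thesis using G(4) Q(1) unfolding V(2) by blast
    qed
  qed (use S in auto)
qed

section \<open>Lattice structure and embedding\<close>

text \<open>Meets are intersections. A union need not be stable under joins of values, so a join is
  the intersection of all common upper bounds, a non-empty family by \<open>SR_top\<close>.\<close>

lemma lattice_C: "Lattice.lattice C"
proof -
  have po: "partial_order C"
    by unfold_locales (auto simp: CSAmb_def)
  interpret partial_order C by (rule po)
  show ?thesis
  proof unfold_locales
    fix R S assume "R \<in> carrier C" "S \<in> carrier C"
    then have RS: "SR R" "SR S" by simp_all
    let ?M = "{Q. SR Q \<and> R \<subseteq> Q \<and> S \<subseteq> Q}"
    have "exp_set X \<times> exp_set Y \<times> carrier L \<in> ?M" using SR_top SR_D(1)[OF RS(1)] SR_D(1)[OF RS(2)] by simp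
    then have "SR (\<Inter>?M)" by (intro SR_Inter) blast+
    then have "least C (\<Inter>?M) (Upper C {R, S})"
      using RS unfolding least_def Upper_def by (auto simp: CSAmb_def)
    then show "\<exists>s. least C s (Upper C {R, S})" ..
  next
    fix R S assume "R \<in> carrier C" "S \<in> carrier C"
    then have RS: "SR R" "SR S" by simp_all
    then have "SR (R \<inter> S)" using SR_Inter[of "{R, S}"] by auto
    then have "greatest C (R \<inter> S) (Lower C {R, S})"
      using RS unfolding greatest_def Lower_def by (auto simp: CSAmb_def)
    then show "\<exists>s. greatest C s (Lower C {R, S})" ..
  qed
qed

text \<open>This order property is all that continuity and the base of subsemilattices use about
  joins.\<close>

lemma join_C:
  assumes "SR R" "SR S"
  shows "SR (R \<squnion>\<^bsub>C\<^esub> S)" "R \<subseteq> R \<squnion>\<^bsub>C\<^esub> S" "S \<subseteq> R \<squnion>\<^bsub>C\<^esub> S" "\<lbrakk>SR Q; R \<subseteq> Q; S \<subseteq> Q\<rbrakk> \<Longrightarrow> R \<squnion>\<^bsub>C\<^esub> S \<subseteq> Q"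
proof -
  interpret C: Lattice.lattice C by (rule lattice_C)
  have [simp]: "le C = (\<subseteq>)" by (simp add: CSAmb_def)
  show "SR (R \<squnion>\<^bsub>C\<^esub> S)" using C.join_closed[of R S] assms by simp
  show "R \<subseteq> R \<squnion>\<^bsub>C\<^esub> S" "S \<subseteq> R \<squnion>\<^bsub>C\<^esub> S" using C.join_left[of R S] C.join_right[of R S] assms by simp_all
  show "R \<squnion>\<^bsub>C\<^esub> S \<subseteq> Q" if "SR Q" "R \<subseteq> Q" "S \<subseteq> Q"
    using C.join_le[of R Q S] assms that by simp
qed

lemma inj_on_rep_cup: "inj_on cup (Collect SR)"
proof (rule inj_onI)
  have sub: "R \<subseteq> S" if "SR R" "SR S" "cup R = cup S" for R S
  proof
    fix x assume x: "x \<in> R"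
    obtain A B \<alpha> where xx: "x = (A, B, \<alpha>)" by (cases x)
    have "A \<in> exp_set X" using SR_D(1)[OF that(1)] x xx by blast
    then show "x \<in> S" using rep_cup_sing[OF that(1)] rep_cup_sing[OF that(2)] x that(3) unfolding xx by blast
  qed
  show "R = S" if "R \<in> Collect SR" "S \<in> Collect SR" "cup R = cup S" for R S
    using sub[of R S] sub[of S R] that by auto
qed

lemma embedding_rep_cup: "embedding_map \<tau> (cup_hyperspace X Y T) cup"
proof -
  let ?I = "subtopology (vietoris Z) (cup ` Collect SR)"
  have "embedding_map \<tau> ?I cup"
  proof (rule injective_open_imp_embedding_map)
    have "continuous_map \<tau> (vietoris Z) cup"
      unfolding continuous_map_alt topspace_\<tau> topspace_vietoris
    proof (intro conjI allI impI)
      fix \<V> assume "openin (vietoris Z) \<V>"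
      moreover have "cup -` \<V> \<inter> Collect SR = {R. SR R \<and> cup R \<in> \<V>}" by auto
      ultimately show "openin \<tau> (cup -` \<V> \<inter> Collect SR)" unfolding openin_\<tau> by (intro exI conjI)
    qed (use rep_cup_exp in auto)
    then show "continuous_map \<tau> ?I cup"
      unfolding continuous_map_in_subtopology topspace_\<tau> by auto
    show "open_map \<tau> ?I cup"
      unfolding open_map_def
    proof (intro allI impI)
      fix N assume "openin \<tau> N"
      then obtain \<V> where V: "openin (vietoris Z) \<V>" "N = {R. SR R \<and> cup R \<in> \<V>}"
        unfolding openin_\<tau> by blast
      have "cup ` N = \<V> \<inter> cup ` Collect SR" unfolding V(2) by auto
      then show "openin ?I (cup ` N)" using V(1) unfolding openin_subtopology by blast
    qed
    show "inj_on cup (topspace \<tau>)" unfolding topspace_\<tau> by (rule inj_on_rep_cup)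
  qed
  then show ?thesis unfolding embedding_map_in_subtopology cup_hyperspace_def by blast
qed

section \<open>Separation and compactness of the topology\<close>

lemma Hausdorff_\<tau>: "Hausdorff_space \<tau>"
proof -
  have "Hausdorff_space (cup_hyperspace X Y T)"
    unfolding cup_hyperspace_def using compact_Z Hausdorff_Z by (rule Hausdorff_space_vietoris)
  then show ?thesis
    using embedding_map_imp_homeomorphic_space[OF embedding_rep_cup] homeomorphic_Hausdorff_space
      Hausdorff_space_subtopology by blast
qed

text \<open>Among the members of a cover by subbasic sets, those of the form \<open>{R. \<not> R \<subseteq> H}\<close> all miss the
  intersection of their \<open>H\<close>, so this intersection lies in a member of the other kind; by
  compactness already finitely many \<open>H\<close> suffice there.\<close>

lemma compact_\<tau>: "compact_space \<tau>"
proof (rule compact_space_subbaseI)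
  define hit where "hit = (\<lambda>H. {R. SR R \<and> \<not> R \<subseteq> H})"
  define miss where "miss = (\<lambda>K. {R. SR R \<and> R \<inter> K = {}})"
  let ?\<B> = "hit ` caps \<union> miss ` Collect (closedin P)"
  have "miss {} = Collect SR" by (simp add: miss_def)
  moreover have "miss {} \<in> ?\<B>" by (intro UnI2 imageI) simp
  ultimately have "Collect SR \<subseteq> \<Union>?\<B>" by (metis Union_upper)
  moreover have "hit H \<subseteq> Collect SR" "miss K \<subseteq> Collect SR" for H K
    unfolding hit_def miss_def by auto
  then have "\<Union>?\<B> \<subseteq> Collect SR" by blast
  ultimately show "\<Union>?\<B> = topspace \<tau>" unfolding topspace_\<tau> by (rule subset_antisym[rotated])
  have "openin \<tau> (hit H)" if "H \<in> caps" for H unfolding hit_def by (rule openin_not_subset_caps[OF that])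
  moreover have "openin \<tau> (miss K)" if "closedin P K" for K unfolding miss_def by (rule openin_avoiding[OF that])
  ultimately show "openin \<tau> B" if "B \<in> ?\<B>" for B using that by blast
  show "\<exists>\<F>. finite \<F> \<and> \<F> \<subseteq> ?\<B> \<and> R \<in> \<Inter>\<F> \<and> topspace \<tau> \<inter> \<Inter>\<F> \<subseteq> N"
    if N: "openin \<tau> N" "R \<in> N" for N R
  proof -
    have R: "SR R" using openin_subset[OF N(1)] N(2) unfolding topspace_\<tau> by blast
    obtain \<H> S K where H: "finite \<H>" "\<H> \<subseteq> caps" "\<And>H. H \<in> \<H> \<Longrightarrow> \<not> R \<subseteq> H" "SR S" "closedin P K" "R \<inter> K = {}"
      "\<And>Q. \<lbrakk>SR Q; Q \<inter> K = {}\<rbrakk> \<Longrightarrow> Q \<subseteq> S"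
      "\<And>Q. \<lbrakk>SR Q; Q \<subseteq> S; \<And>H. H \<in> \<H> \<Longrightarrow> \<not> Q \<subseteq> H\<rbrakk> \<Longrightarrow> Q \<in> N"
      using nbhd_form[OF N] by metis
    show ?thesis
    proof (intro exI[of _ "insert (miss K) (hit ` \<H>)"] conjI)
      show "insert (miss K) (hit ` \<H>) \<subseteq> ?\<B>" using H(2,5) by blast
      show "R \<in> \<Inter>(insert (miss K) (hit ` \<H>))" using R H(3,6) unfolding hit_def miss_def by blast
      show "topspace \<tau> \<inter> \<Inter>(insert (miss K) (hit ` \<H>)) \<subseteq> N"
      proof
        fix Q assume "Q \<in> topspace \<tau> \<inter> \<Inter>(insert (miss K) (hit ` \<H>))"
        then have Q: "SR Q" "Q \<inter> K = {}" "\<And>H. H \<in> \<H> \<Longrightarrow> \<not> Q \<subseteq> H" unfolding hit_def miss_def by auto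
        show "Q \<in> N" using H(8)[OF Q(1) H(7)[OF Q(1,2)] Q(3)] .
      qed
    qed (simp add: H(1))
  qed
  fix \<C> assume \<C>: "\<C> \<subseteq> ?\<B>" "\<Union>\<C> = topspace \<tau>"
  define \<H> where "\<H> = {H \<in> caps. hit H \<in> \<C>}"
  let ?top = "exp_set X \<times> exp_set Y \<times> carrier L"
  \<comment> \<open>The test point for the cover, the largest representation in none of the chosen
    hit sets; \<open>?top\<close> covers the case of an empty \<open>\<H>\<close>.\<close>
  let ?S = "\<Inter>(insert ?top \<H>)"
  have "SR R" if "R \<in> insert ?top \<H>" for R
    using that SR_caps SR_top unfolding \<H>_def by auto
  then have "SR ?S" by (intro SR_Inter) simp_all
  then have "?S \<in> \<Union>\<C>" unfolding \<C>(2) topspace_\<tau> by simp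
  then obtain B where B: "?S \<in> B" "B \<in> \<C>" by (elim UnionE)
  have "B \<notin> hit ` caps"
  proof
    assume "B \<in> hit ` caps"
    then obtain H where H: "H \<in> caps" "B = hit H" by (elim imageE)
    then have "H \<in> \<H>" using B(2) unfolding \<H>_def by simp
    then have "?S \<subseteq> H" by blast
    then show False using B(1) unfolding H(2) hit_def by simp
  qed
  moreover have "B \<in> ?\<B>" using B(2) \<C>(1) by (rule subsetD[rotated])
  ultimately have "B \<in> miss ` Collect (closedin P)" by simp
  then obtain K where K: "closedin P K" "B = miss K" by auto
  have Kc: "compactin P K" using K(1) compact_P by (simp add: closedin_compact_space)
  have "K \<subseteq> \<Union>((\<lambda>H. topspace P - H) ` \<H>)"
  proof
    fix x assume x: "x \<in> K"
    then have xt: "x \<in> topspace P" using closedin_subset[OF K(1)] by blast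
    have "?S \<inter> K = {}" using B(1) unfolding K(2) miss_def by simp
    then have "x \<notin> ?S" using x by blast
    then obtain H where "H \<in> \<H>" "x \<notin> H" using xt unfolding topspace_P by blast
    then show "x \<in> \<Union>((\<lambda>H. topspace P - H) ` \<H>)" using xt by (intro UN_I[of H]) auto
  qed
  moreover have "openin P W" if "W \<in> (\<lambda>H. topspace P - H) ` \<H>" for W
  proof -
    from that obtain H where "H \<in> \<H>" "W = topspace P - H" by (elim imageE)
    then show ?thesis
      using openin_diff[OF openin_topspace closedin_caps[of H]] unfolding \<H>_def by simp
  qed
  ultimately obtain \<F> where F0: "finite \<F>" "\<F> \<subseteq> (\<lambda>H. topspace P - H) ` \<H>" "K \<subseteq> \<Union>\<F>"
    using compactinD[OF Kc, of "(\<lambda>H. topspace P - H) ` \<H>"] by meson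
  from finite_subset_image[OF F0(1,2)] obtain F where F: "F \<subseteq> \<H>" "finite F" "\<F> = (\<lambda>H. topspace P - H) ` F"
    by (elim exE conjE)
  show "\<exists>\<C>'. finite \<C>' \<and> \<C>' \<subseteq> \<C> \<and> \<Union>\<C>' = topspace \<tau>"
  proof (intro exI[of _ "insert B (hit ` F)"] conjI)
    show sub: "insert B (hit ` F) \<subseteq> \<C>" using B(2) F(1) unfolding \<H>_def by auto
    show "\<Union>(insert B (hit ` F)) = topspace \<tau>"
    proof
      show "\<Union>(insert B (hit ` F)) \<subseteq> topspace \<tau>" using sub \<C>(2) by blast
      show "topspace \<tau> \<subseteq> \<Union>(insert B (hit ` F))"
      proof
        fix Q assume "Q \<in> topspace \<tau>"
        then have Q: "SR Q" unfolding topspace_\<tau> by simp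
        show "Q \<in> \<Union>(insert B (hit ` F))"
        proof (cases "\<exists>H\<in>F. \<not> Q \<subseteq> H")
          case True
          then obtain H where "H \<in> F" "Q \<in> hit H" using Q unfolding hit_def by auto
          then show ?thesis by blast
        next
          case False
          then have "Q \<inter> K = {}" using F0(3) unfolding F(3) by blast
          then show ?thesis using Q unfolding K(2) miss_def by simp
        qed
      qed
    qed
  qed (simp add: F(2))
qed

section \<open>The Lawson upper semilattice\<close>

lemma openin_nbhd:
  assumes "finite \<H>" "\<H> \<subseteq> caps" "closedin P K"
  shows "openin \<tau> {Q. SR Q \<and> Q \<inter> K = {} \<and> (\<forall>H\<in>\<H>. \<not> Q \<subseteq> H)}"
proof -
  have "openin \<tau> ({R. SR R \<and> R \<inter> K = {}} \<inter> \<Inter>((\<lambda>H. {R. SR R \<and> \<not> R \<subseteq> H}) ` \<H>))"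
    using assms openin_avoiding openin_not_subset_caps by (intro openin_Int_Inter) auto
  moreover have "{R. SR R \<and> R \<inter> K = {}} \<inter> \<Inter>((\<lambda>H. {R. SR R \<and> \<not> R \<subseteq> H}) ` \<H>) =
      {Q. SR Q \<and> Q \<inter> K = {} \<and> (\<forall>H\<in>\<H>. \<not> Q \<subseteq> H)}" by blast
  ultimately show ?thesis by simp
qed

text \<open>A cap \<open>H\<close> is itself a representation, so a join escapes \<open>H\<close>
  only if one of its parts does; each \<open>H\<close> is imposed on the parts that escape it at
  \<open>(R1, R2)\<close>. Disjointness from \<open>K\<close> is not known to pass to joins, but it
  puts both parts into \<open>S\<close>, and hence their join.\<close>

lemma continuous_join: "continuous_map (prod_topology \<tau> \<tau>) \<tau> (\<lambda>(R, S). R \<squnion>\<^bsub>C\<^esub> S)"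
  unfolding continuous_map_alt
proof (intro conjI allI impI)
  show "(\<lambda>(R, S). R \<squnion>\<^bsub>C\<^esub> S) \<in> topspace (prod_topology \<tau> \<tau>) \<rightarrow> topspace \<tau>"
    using join_C(1) by (auto simp: topspace_\<tau>)
  fix N assume N: "openin \<tau> N"
  let ?M = "(\<lambda>(R, S). R \<squnion>\<^bsub>C\<^esub> S) -` N \<inter> topspace (prod_topology \<tau> \<tau>)"
  show "openin (prod_topology \<tau> \<tau>) ?M"
    unfolding openin_prod_topology_alt
  proof (intro allI impI)
    fix R1 R2 assume "(R1, R2) \<in> ?M"
    then have J: "R1 \<squnion>\<^bsub>C\<^esub> R2 \<in> N" and R: "SR R1" "SR R2" by (auto simp: topspace_\<tau>)
    obtain \<H> S K where H: "finite \<H>" "\<H> \<subseteq> caps" "\<And>H. H \<in> \<H> \<Longrightarrow> \<not> R1 \<squnion>\<^bsub>C\<^esub> R2 \<subseteq> H" "SR S"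
      "closedin P K" "(R1 \<squnion>\<^bsub>C\<^esub> R2) \<inter> K = {}"
      "\<And>Q. \<lbrakk>SR Q; Q \<inter> K = {}\<rbrakk> \<Longrightarrow> Q \<subseteq> S"
      "\<And>Q. \<lbrakk>SR Q; Q \<subseteq> S; \<And>H. H \<in> \<H> \<Longrightarrow> \<not> Q \<subseteq> H\<rbrakk> \<Longrightarrow> Q \<in> N"
      using nbhd_form[OF N J] by metis
    let ?H1 = "{H \<in> \<H>. \<not> R1 \<subseteq> H}" and ?H2 = "{H \<in> \<H>. \<not> R2 \<subseteq> H}"
    let ?U1 = "{Q. SR Q \<and> Q \<inter> K = {} \<and> (\<forall>H\<in>?H1. \<not> Q \<subseteq> H)}"
    let ?U2 = "{Q. SR Q \<and> Q \<inter> K = {} \<and> (\<forall>H\<in>?H2. \<not> Q \<subseteq> H)}"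
    have "openin \<tau> ?U1" by (rule openin_nbhd) (use H(1,2,5) in auto)
    moreover have "openin \<tau> ?U2" by (rule openin_nbhd) (use H(1,2,5) in auto)
    moreover have "R1 \<in> ?U1" "R2 \<in> ?U2" using R join_C(2,3)[OF R] H(6) by blast+
    moreover have "?U1 \<times> ?U2 \<subseteq> ?M"
    proof (clarify, intro IntI vimageI2)
      fix Q1 Q2 assume Q: "SR Q1" "Q1 \<inter> K = {}" "\<forall>H\<in>?H1. \<not> Q1 \<subseteq> H" "SR Q2" "Q2 \<inter> K = {}" "\<forall>H\<in>?H2. \<not> Q2 \<subseteq> H"
      show "(Q1, Q2) \<in> topspace (prod_topology \<tau> \<tau>)" using Q by (simp add: topspace_\<tau>)
      have "Q1 \<squnion>\<^bsub>C\<^esub> Q2 \<subseteq> S" by (rule join_C(4)[OF Q(1,4) H(4) H(7)[OF Q(1,2)] H(7)[OF Q(4,5)]])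
      moreover have "\<not> Q1 \<squnion>\<^bsub>C\<^esub> Q2 \<subseteq> H" if "H \<in> \<H>" for H
      proof
        assume le: "Q1 \<squnion>\<^bsub>C\<^esub> Q2 \<subseteq> H"
        then have "Q1 \<subseteq> H" "Q2 \<subseteq> H" using join_C(2,3)[OF Q(1,4)] by blast+
        then have "R1 \<subseteq> H" "R2 \<subseteq> H" using Q(3,6) that by blast+
        moreover have "SR H" using SR_caps H(2) that by blast
        ultimately have "R1 \<squnion>\<^bsub>C\<^esub> R2 \<subseteq> H" using join_C(4)[OF R] by blast
        then show False using H(3) that by blast
      qed
      ultimately have "Q1 \<squnion>\<^bsub>C\<^esub> Q2 \<in> N" by (rule H(8)[OF join_C(1)[OF Q(1,4)]])
      then show "(case (Q1, Q2) of (R, S) \<Rightarrow> R \<squnion>\<^bsub>C\<^esub> S) \<in> N" by simp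
    qed
    ultimately show "\<exists>U V. openin \<tau> U \<and> openin \<tau> V \<and> R1 \<in> U \<and> R2 \<in> V \<and> U \<times> V \<subseteq> ?M"
      by (intro exI[of _ ?U1] exI[of _ ?U2] conjI)
  qed
qed

text \<open>Containment in the representation \<open>S\<close> passes to joins, and escaping a cap
  is inherited by larger sets, so \<open>?V\<close> is stable under joins. \<open>?U\<close>
  replaces containment in \<open>S\<close> by disjointness from \<open>K\<close>, which makes it
  open.\<close>

lemma subsemilattice_base: "neighbourhood_base_at R (upper_subsemilattice C) \<tau>"
  unfolding neighbourhood_base_at_def
proof (intro allI impI, elim conjE)
  fix N assume N: "openin \<tau> N" "R \<in> N"
  then have R: "SR R" using openin_subset[OF N(1)] unfolding topspace_\<tau> by blast
  obtain \<H> S K where H: "finite \<H>" "\<H> \<subseteq> caps" "\<And>H. H \<in> \<H> \<Longrightarrow> \<not> R \<subseteq> H" "SR S" "closedin P K" "R \<inter> K = {}"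
    "\<And>Q. \<lbrakk>SR Q; Q \<inter> K = {}\<rbrakk> \<Longrightarrow> Q \<subseteq> S"
    "\<And>Q. \<lbrakk>SR Q; Q \<subseteq> S; \<And>H. H \<in> \<H> \<Longrightarrow> \<not> Q \<subseteq> H\<rbrakk> \<Longrightarrow> Q \<in> N"
    using nbhd_form[OF N] by metis
  let ?U = "{Q. SR Q \<and> Q \<inter> K = {} \<and> (\<forall>H\<in>\<H>. \<not> Q \<subseteq> H)}"
  let ?V = "{Q. SR Q \<and> Q \<subseteq> S \<and> (\<forall>H\<in>\<H>. \<not> Q \<subseteq> H)}"
  show "\<exists>U V. openin \<tau> U \<and> upper_subsemilattice C V \<and> R \<in> U \<and> U \<subseteq> V \<and> V \<subseteq> N"
  proof (rule exI[of _ ?U], rule exI[of _ ?V], intro conjI)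
    show "openin \<tau> ?U" using H(1,2,5) by (rule openin_nbhd)
    show "upper_subsemilattice C ?V"
      unfolding upper_subsemilattice_def
    proof (intro conjI ballI)
      show "?V \<subseteq> carrier C" by auto
      fix Q1 Q2 assume "Q1 \<in> ?V" "Q2 \<in> ?V"
      then have Q: "SR Q1" "SR Q2" "Q1 \<subseteq> S" "Q2 \<subseteq> S" "\<forall>H\<in>\<H>. \<not> Q1 \<subseteq> H" by auto
      have "Q1 \<squnion>\<^bsub>C\<^esub> Q2 \<subseteq> S" by (rule join_C(4)[OF Q(1,2) H(4) Q(3,4)])
      moreover have "\<not> Q1 \<squnion>\<^bsub>C\<^esub> Q2 \<subseteq> H" if "H \<in> \<H>" for H
        using subset_trans[OF join_C(2)[OF Q(1,2)]] Q(5) that by metis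
      ultimately show "Q1 \<squnion>\<^bsub>C\<^esub> Q2 \<in> ?V" using join_C(1)[OF Q(1,2)] by simp
    qed
    show "R \<in> ?U" using R H(3,6) by simp
    show "?U \<subseteq> ?V" using H(7) by (intro Collect_mono) simp
    show "?V \<subseteq> N" using H(8) by (intro subsetI) simp
  qed
qed

lemma Lawson_C: "Lawson_upper_semilattice \<tau> C"
proof -
  have "upper_semilattice C" using lattice_C by (simp add: Lattice.lattice_def)
  then show ?thesis
    unfolding Lawson_upper_semilattice_def topological_upper_semilattice_def
    using Hausdorff_\<tau> continuous_join subsemilattice_base by (simp add: topspace_\<tau>)
qed

end

theorem mainTheorem2:
  fixes X :: "'a topology" and Y :: "'b topology"
    and L :: "'l gorder" and T :: "'l topology"
  assumes "compact_space X" "Hausdorff_space X" "topspace X \<noteq> {}"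
    and "compact_space Y" "Hausdorff_space Y" "topspace Y \<noteq> {}"
    and "compact_space T" "Lawson_lattice T L" "carrier L \<noteq> {}"
  shows "lattice (CSAmb X Y T L) \<and>
    embedding_map (CSAmb_topology X Y T L) (cup_hyperspace X Y T) (rep_cup X Y L) \<and>
    compact_space (CSAmb_topology X Y T L) \<and>
    Hausdorff_space (CSAmb_topology X Y T L) \<and>
    Lawson_upper_semilattice (CSAmb_topology X Y T L) (CSAmb X Y T L)"
proof -
  have "Lattice.lattice L" using assms(8) by (simp add: Lawson_lattice_def)
  moreover have "compact_Lawson_lattice_axioms L T"
    using assms(7-9)
    by (simp add: compact_Lawson_lattice_axioms_def Lawson_lattice_def Lawson_lower_semilattice_def)
  ultimately interpret strict_representations L T X Y
    by (intro strict_representations.intro compact_Lawson_lattice.intro strict_representations_axioms.intro assms(1-6))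
  show ?thesis
    using lattice_C embedding_rep_cup compact_\<tau> Hausdorff_\<tau> Lawson_C by (intro conjI)
qed

end
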